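(* For every infinite cardinal $\lambda$ there exists a Noetherian integral domain $R$ of cardinality $\lambda$ whose additive group $R^+ = (R,+)$ is a free abelian group.
   Context: For a ring $R$, $R^+$ denotes its additive group. An integral domain is a nonzero commutative ring with identity and without zero divisors. *)

theory Defs
  imports "HOL-Algebra.Algebra" "HOL-Algebra.Free_Abelian_Groups"
begin

unbundle cardinal_syntax

text \<open>
  A basis of a group is a subset of its carrier, so letting the index set \<open>S\<close> of the free abelian
  group range over sets of elements of type \<open>'a\<close> loses no generality. Since \<open>iso\<close> only looks at
  carriers and multiplications, \<open>comm_group\<close> is needed to tie down the unit of \<open>G\<close>.
\<close>
definition is_free_abelian :: "('a, 'm) monoid_scheme \<Rightarrow> bool"
  where "is_free_abelian G \<longleftrightarrow> comm_group G \<and> (\<exists>S :: 'a set. G \<cong> free_Abelian_group S)"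

end

theory Submission
  imports Defs "HOL-Computational_Algebra.Polynomial_Factorial"
begin

text \<open>
  The ring is the localization of the polynomial ring over \<open>\<int>\<close> in \<open>\<lambda>\<close> indeterminates at the primitive
  polynomials. By Gauss' lemma each of its elements is an integer times a unit, so every ideal is
  generated by an integer.

  Let \<open>R(F)\<close> be this ring for the indeterminates \<open>x\<^sub>i\<close> (\<open>i \<in> F\<close>) and countably many spare ones, so
  that the ring in question is the union of the \<open>R(F)\<close> for finite \<open>F\<close>. Let \<open>\<sigma>\<^sub>i\<close> replace \<open>x\<^sub>i\<close> by a new
  indeterminate and put \<open>D\<^sub>F = \<Prod>\<^sub>i (1 - \<sigma>\<^sub>i)\<close> over \<open>i \<in> F\<close>. Then \<open>D\<^sub>F\<close> vanishes on \<open>R(E)\<close> unless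
  \<open>F \<subseteq> E\<close>, and renaming the new indeterminates to unused spare ones shows that its kernel on \<open>R(F)\<close>
  is the sum of the \<open>R(F - {i})\<close>. The group \<open>D\<^sub>F R(F)\<close> is countable and free by Pontryagin's criterion,
  and the lifts of bases of these groups, for all finite \<open>F\<close>, together form a basis.
\<close>

section \<open>Countable free groups\<close>

text \<open>Commutative rings are regarded as modules over the integers:
  \<open>zmod.subspace\<close> then says additive subgroup, and an independent spanning set is a
  basis of a free abelian group. The rational structure \<open>qvs\<close> below serves to measure
  rank.\<close>

interpretation zmod: Modules.module "\<lambda>(n::int) (x::'k::comm_ring_1). of_int n * x"
  by unfold_locales (simp_all add: algebra_simps)

interpretation qvs: vector_space "\<lambda>(q::rat) (x::'k::field_char_0). of_rat q * x"
  by unfold_locales (simp_all add: algebra_simps of_rat_add of_rat_mult)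

text \<open>The least positive member divides all others by division with remainder. This is applied
  to the values of a functional in Pontryagin's criterion and to the integers in an ideal in the
  proof of the Noetherian property.\<close>

lemma int_subgroup_principal:
  fixes S :: "int set"
  assumes "0 \<in> S" and diff: "\<And>x y. x \<in> S \<Longrightarrow> y \<in> S \<Longrightarrow> x - y \<in> S"
  obtains d where "d \<in> S" "\<And>x. x \<in> S \<Longrightarrow> d dvd x"
proof (cases "S = {0}")
  case True
  then show ?thesis using that by auto
next
  case False
  have neg: "- x \<in> S" if "x \<in> S" for x
    using diff[OF \<open>0 \<in> S\<close> that] by simp
  have add: "x + y \<in> S" if "x \<in> S" "y \<in> S" for x y
    using diff[OF that(1) neg[OF that(2)]] by simp
  have mul_nat: "of_nat n * x \<in> S" if "x \<in> S" for n x
    by (induction n) (use \<open>0 \<in> S\<close> add that in \<open>auto simp: algebra_simps\<close>)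
  have mul: "k * x \<in> S" if "x \<in> S" for k x
    using mul_nat[OF that, of "nat k"] neg[OF mul_nat[OF that, of "nat (- k)"]]
    by (cases "0 \<le> k") auto
  obtain x where "x \<in> S" "x \<noteq> 0" using False \<open>0 \<in> S\<close> by auto
  hence ex: "\<exists>n::nat. n > 0 \<and> int n \<in> S"
    using neg by (intro exI[of _ "nat \<bar>x\<bar>"]) (auto simp: abs_if)
  define d where "d = (LEAST n::nat. n > 0 \<and> int n \<in> S)"
  have d: "d > 0" "int d \<in> S" using LeastI_ex[OF ex] by (auto simp: d_def)
  have "int d dvd y" if "y \<in> S" for y
  proof -
    have "y mod int d = y - (y div int d) * int d"
      by (simp add: minus_div_mult_eq_mod)
    hence "y mod int d \<in> S" using diff that mul d by metis
    moreover have "y mod int d \<ge> 0" "y mod int d < int d" using d by auto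
    ultimately have "\<not> y mod int d > 0"
      using not_less_Least[of "nat (y mod int d)" "\<lambda>n. n > 0 \<and> int n \<in> S"]
      unfolding d_def[symmetric] by auto
    with \<open>y mod int d \<ge> 0\<close> show ?thesis by (simp add: dvd_eq_mod_eq_0)
  qed
  then show ?thesis using that d by blast
qed

text \<open>The product of the denominators of the finitely many values on generators clears the
  denominators of all values.\<close>

lemma bounded_denominator:
  fixes l :: "'k::comm_ring_1 \<Rightarrow> rat"
  assumes add: "\<And>x y. l (x + y) = l x + l y" and scale: "\<And>n x. l (of_int n * x) = of_int n * l x"
    and "finite T"
  obtains N where "N > 0" "\<And>x. x \<in> zmod.span T \<Longrightarrow> of_int N * l x \<in> \<int>"
proof -
  define N where "N = (\<Prod>t\<in>T. snd (quotient_of (l t)))"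
  have pos: "N > 0" unfolding N_def
    by (intro prod_pos) (auto simp: quotient_of_denom_pos')
  have gen: "of_int N * l t \<in> \<int>" if "t \<in> T" for t
  proof -
    define r where "r = (\<Prod>t\<in>T - {t}. snd (quotient_of (l t)))"
    have N: "N = snd (quotient_of (l t)) * r"
      unfolding N_def r_def using that \<open>finite T\<close> by (simp add: prod.remove)
    have "l t = of_int (fst (quotient_of (l t))) / of_int (snd (quotient_of (l t)))"
      by (cases "quotient_of (l t)") (auto dest: quotient_of_div)
    moreover have "snd (quotient_of (l t)) \<noteq> 0" using quotient_of_denom_pos'[of "l t"] by simp
    ultimately have "of_int N * l t = of_int (r * fst (quotient_of (l t)))"
      unfolding N by (simp add: field_simps)
    thus ?thesis by (metis Ints_of_int)
  qed
  have "l 0 = 0" using add[of 0 0] by simp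
  have "of_int N * l x \<in> \<int>" if "x \<in> zmod.span T" for x
    using that
  proof (induction rule: zmod.span_induct_alt)
    case base
    then show ?case by (simp add: \<open>l 0 = 0\<close>)
  next
    case (step c x y)
    have eq: "of_int N * l (of_int c * x + y) = of_int c * (of_int N * l x) + of_int N * l y"
      by (simp only: add scale distrib_left mult.left_commute)
    show ?case unfolding eq using step gen by (blast intro: Ints_add Ints_mult Ints_of_int)
  qed
  with pos show ?thesis using that by blast
qed

text \<open>After multiplication by a common denominator, the values of \<open>l\<close> on
  \<open>G\<close> form a subgroup of the integers; \<open>u\<close> is a preimage of its
  generator.\<close>

lemma functional_generator:
  fixes l :: "'k::comm_ring_1 \<Rightarrow> rat"
  assumes add: "\<And>x y. l (x + y) = l x + l y" and scale: "\<And>n x. l (of_int n * x) = of_int n * l x"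
    and "finite T" "zmod.subspace G" "G \<subseteq> zmod.span T"
  obtains u where "u \<in> G" "\<And>y. y \<in> G \<Longrightarrow> \<exists>k::int. l y = of_int k * l u"
proof -
  obtain N where N: "N > 0" "\<And>x. x \<in> zmod.span T \<Longrightarrow> of_int N * l x \<in> \<int>"
    using bounded_denominator[of l T] add scale \<open>finite T\<close> by blast
  define S where "S = {k::int. \<exists>y\<in>G. of_int k = of_int N * l y}"
  have diff: "l (x - y) = l x - l y" for x y
    using add[of x "of_int (-1) * y"] scale[of "-1" y] by simp
  have "0 \<in> S"
    unfolding S_def using zmod.subspace_0[OF assms(4)] add[of 0 0] by (auto intro!: bexI[of _ 0])
  moreover have "x - y \<in> S" if xy: "x \<in> S" "y \<in> S" for x y
  proof -
    from xy obtain a b where "a \<in> G" "b \<in> G" "of_int x = of_int N * l a" "of_int y = of_int N * l b"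
      by (auto simp: S_def)
    thus ?thesis unfolding S_def
      by (auto intro!: bexI[of _ "a - b"] simp: diff algebra_simps zmod.subspace_diff[OF assms(4)])
  qed
  ultimately obtain d where d: "d \<in> S" "\<And>x. x \<in> S \<Longrightarrow> d dvd x"
    using int_subgroup_principal by blast
  then obtain u where u: "u \<in> G" "of_int d = of_int N * l u" by (auto simp: S_def)
  have "\<exists>k::int. l y = of_int k * l u" if "y \<in> G" for y
  proof -
    have "of_int N * l y \<in> \<int>" using N(2) that assms(5) by blast
    then obtain e where e: "of_int e = of_int N * l y" by (metis Ints_cases)
    hence "e \<in> S" using that by (auto simp: S_def)
    then obtain k where "e = d * k" using d by (auto simp: dvd_def)
    hence "of_int N * l y = of_int N * (of_int k * l u)"
      using e u by (metis mult.assoc mult.commute of_int_mult)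
    thus ?thesis using N(1) by auto
  qed
  with u that show ?thesis by blast
qed

text \<open>
  Pontryagin's criterion. For a rational basis \<open>b\<^sub>0, b\<^sub>1, \<dots>\<close> of the span of \<open>H\<close>, the coordinate
  functional of \<open>b\<^sub>n\<close> maps \<open>G \<inter> \<langle>b\<^sub>0, \<dots>, b\<^sub>n\<rangle>\<close> onto a cyclic subgroup of the rationals; lifts of
  the generators of these groups form an integral basis of \<open>G\<close>.
\<close>
lemma countable_group_has_basis:
  fixes G H :: "'k::field_char_0 set"
  assumes "countable H" "G \<subseteq> H" and G: "zmod.subspace G"
    and fin: "\<And>B. finite B \<Longrightarrow> B \<subseteq> H \<Longrightarrow> \<exists>T. finite T \<and> H \<inter> qvs.span B \<subseteq> zmod.span T"
  obtains U where "U \<subseteq> G" "zmod.independent U" "G \<subseteq> zmod.span U"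
proof -
  obtain B where B: "B \<subseteq> H" "qvs.independent B" "H \<subseteq> qvs.span B"
    using qvs.maximal_independent_subset by blast
  have cB: "countable B" using B(1) \<open>countable H\<close> countable_subset by blast
  define idx where "idx = to_nat_on B"
  have inj: "inj_on idx B" unfolding idx_def using cB by (rule inj_on_to_nat_on)
  define Bn where "Bn n = {b\<in>B. idx b < n}" for n
  define Gn where "Gn n = G \<inter> qvs.span (Bn n)" for n
  have finBn: "finite (Bn n)" for n
    by (rule inj_on_finite[OF inj_on_subset[OF inj], of _ "{..<n}"]) (auto simp: Bn_def)
  have BnB: "Bn n \<subseteq> B" for n by (auto simp: Bn_def)
  have zq: "zmod.subspace (qvs.span S)" for S :: "'k set"
  proof (rule zmod.subspaceI)
    fix c :: int and x assume "x \<in> qvs.span S"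
    from qvs.span_scale[OF this, of "of_int c"] show "of_int c * x \<in> qvs.span S" by simp
  qed (auto intro: qvs.span_add qvs.span_zero)
  have GnS: "zmod.subspace (Gn n)" for n
    unfolding Gn_def using G zq by (rule zmod.subspace_inter)
  define l where "l b x = qvs.representation B x b" for b x
  have mem: "x \<in> qvs.span B" if "x \<in> G" for x using that B assms by blast
  have l_add: "l b (x + y) = l b x + l b y" if "x \<in> G" "y \<in> G" for b x y
    unfolding l_def using qvs.representation_add[OF B(2) mem mem] that by simp
  have l_scale: "l b (of_int k * x) = of_int k * l b x" if "x \<in> G" for b k x
    unfolding l_def using qvs.representation_scale[OF B(2) mem[OF that], of "of_int k"] by simp
  \<comment> \<open>Triangularity: a coordinate vanishes on all levels before its own, and by
    \<open>l_kernel\<close> below its kernel on its own level is the preceding level.\<close>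
  have l_zero: "l b x = 0" if "x \<in> qvs.span (Bn n)" "idx b \<ge> n" for b x n
  proof -
    have "qvs.representation (Bn n) x b = 0"
      using that qvs.representation_ne_zero[of "Bn n" x b] by (auto simp: Bn_def)
    moreover have "qvs.representation (Bn n) x = qvs.representation B x"
      using qvs.representation_extend[OF B(2) that(1) BnB] by simp
    ultimately show ?thesis by (simp add: l_def)
  qed
  have l_kernel: "x \<in> Gn (idx b)" if "x \<in> Gn (Suc (idx b))" "b \<in> B" "l b x = 0" for b x
  proof -
    have ins: "Bn (Suc (idx b)) = insert b (Bn (idx b))"
      using \<open>b \<in> B\<close> inj by (auto simp: Bn_def less_Suc_eq inj_on_def)
    have sp: "x \<in> qvs.span (Bn (Suc (idx b)))" using that by (simp add: Gn_def)
    have ind: "qvs.independent (Bn (Suc (idx b)))" using qvs.independent_mono[OF B(2) BnB] .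
    have eq: "qvs.representation (Bn (Suc (idx b))) x = qvs.representation B x"
      using qvs.representation_extend[OF B(2) sp BnB] by simp
    have "x = (\<Sum>v\<in>Bn (Suc (idx b)). of_rat (qvs.representation B x v) * v)"
      using qvs.sum_representation_eq[OF ind sp finBn order_refl] eq by simp
    also have "\<dots> = (\<Sum>v\<in>Bn (idx b). of_rat (qvs.representation B x v) * v)"
      unfolding ins using that(3) finBn
      by (subst sum.insert) (auto simp: Bn_def l_def)
    also have "\<dots> \<in> qvs.span (Bn (idx b))"
      by (intro qvs.span_sum qvs.span_scale qvs.span_base)
    finally show ?thesis using that by (simp add: Gn_def)
  qed
  have "\<exists>u. u \<in> Gn (Suc (idx b)) \<and> (\<forall>y\<in>Gn (Suc (idx b)). \<exists>k::int. l b y = of_int k * l b u)"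
    if "b \<in> B" for b
  proof -
    \<comment> \<open>The coordinate \<open>l b\<close> is additive only on the span of
      \<open>B\<close>, because \<open>qvs.representation\<close> is zero outside it.
      \<open>functional_generator\<close> wants a functional on the whole type, hence the linear
      extension \<open>L\<close>.\<close>
    obtain L where L: "Vector_Spaces.linear (\<lambda>(q::rat) (x::'k). of_rat q * x) (*) L" 
      and Lext: "\<And>x. x \<in> B \<Longrightarrow> L x = l b x"
    proof -
      interpret vp: vector_space_pair "\<lambda>(q::rat) (x::'k). of_rat q * x" "(*) :: rat \<Rightarrow> rat \<Rightarrow> rat"
        by unfold_locales (simp_all add: algebra_simps of_rat_add of_rat_mult)
      show ?thesis using vp.linear_independent_extend[OF B(2), of "l b"] that by blast
    qed
    interpret L: Vector_Spaces.linear "\<lambda>(q::rat) (x::'k). of_rat q * x" "(*)" L by (rule L)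
    have "x \<in> qvs.span B \<and> L x = l b x" if "x \<in> qvs.span B" for x
      using that
    proof (induction rule: qvs.span_induct_alt)
      case base
      then show ?case by (simp add: L.zero l_def qvs.representation_zero qvs.span_zero)
    next
      case (step c x y)
      have x: "x \<in> qvs.span B" using step by (simp add: qvs.span_base)
      have "L (of_rat c * x + y) = l b (of_rat c * x + y)"
        using qvs.representation_add[OF B(2) qvs.span_scale[OF x, of c], of y]
          qvs.representation_scale[OF B(2) x, of c] Lext[OF step(1)] step(2)
        by (simp add: L.add L.scale l_def add.commute)
      thus ?case using x step by (simp add: qvs.span_add qvs.span_scale)
    qed
    hence Leq: "L x = l b x" if "x \<in> qvs.span B" for x using that by blast
    obtain T where T: "finite T" "H \<inter> qvs.span (Bn (Suc (idx b))) \<subseteq> zmod.span T"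
      using fin[OF finBn] BnB B(1) by blast
    obtain u where "u \<in> Gn (Suc (idx b))"
      "\<And>y. y \<in> Gn (Suc (idx b)) \<Longrightarrow> \<exists>k::int. L y = of_int k * L u"
    proof (rule functional_generator[of L T "Gn (Suc (idx b))"])
      show "L (of_int n * x) = of_int n * L x" for n x
        using L.scale[of "of_int n" x] by simp
      show "Gn (Suc (idx b)) \<subseteq> zmod.span T" using T \<open>G \<subseteq> H\<close> by (auto simp: Gn_def)
    qed (use T GnS L.add in auto)
    moreover have "L y = l b y" if "y \<in> Gn n" for y n
      using that mem Leq by (auto simp: Gn_def)
    ultimately show ?thesis by metis
  qed
  then obtain u where u: "\<And>b. b \<in> B \<Longrightarrow> u b \<in> Gn (Suc (idx b))"
    and ugen: "\<And>b y. b \<in> B \<Longrightarrow> y \<in> Gn (Suc (idx b)) \<Longrightarrow> \<exists>k::int. l b y = of_int k * l b (u b)"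
    by metis
  \<comment> \<open>If \<open>l b (u b) = 0\<close>, then \<open>l b\<close> vanishes on the whole
    level of \<open>b\<close>, which by \<open>l_kernel\<close> adds nothing to the preceding one;
    such lifts are left out.\<close>
  define U where "U = u ` {b\<in>B. l b (u b) \<noteq> 0}"
  have UG: "U \<subseteq> G" using u by (auto simp: U_def Gn_def)
  have "zmod.independent U"
  proof
    assume "zmod.dependent U"
    then obtain T c where T: "finite T" "T \<subseteq> U" "(\<Sum>v\<in>T. of_int (c v) * v) = 0" "\<exists>v\<in>T. c v \<noteq> 0"
      unfolding zmod.dependent_explicit by blast
    \<comment> \<open>The coordinate at the element \<open>b\<close> of largest index in
      \<open>D\<close> vanishes on every other lift occurring with nonzero coefficient, so it
      isolates the coefficient of \<open>u b\<close>.\<close>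
    define D where "D = {b\<in>B. l b (u b) \<noteq> 0 \<and> u b \<in> T \<and> c (u b) \<noteq> 0}"
    have injD: "inj_on u {b\<in>B. l b (u b) \<noteq> 0}"
    proof (rule inj_onI)
      fix a b assume ab: "a \<in> {b\<in>B. l b (u b) \<noteq> 0}" "b \<in> {b\<in>B. l b (u b) \<noteq> 0}" "u a = u b"
      have "False" if "a \<in> B" "l b (u a) \<noteq> 0" "idx a < idx b" for a b
        using that l_zero[of "u a" "Suc (idx a)" b] u[of a] by (auto simp: Gn_def)
      hence "idx a = idx b" using ab by (metis (mono_tags, lifting) mem_Collect_eq nat_neq_iff)
      thus "a = b" using inj ab by (auto simp: inj_on_def)
    qed
    have "finite D"
      by (rule inj_on_finite[OF inj_on_subset[OF injD], of _ T]) (use T in \<open>auto simp: D_def\<close>)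
    moreover have "D \<noteq> {}" using T by (auto simp: D_def U_def)
    ultimately obtain b where b: "b \<in> D" "\<And>a. a \<in> D \<Longrightarrow> idx a \<le> idx b"
    proof -
      assume D: "finite D" "D \<noteq> {}"
      hence "Max (idx ` D) \<in> idx ` D" by simp
      then obtain b where "b \<in> D" "Max (idx ` D) = idx b" by auto
      thus thesis using that[of b] Max_ge[of "idx ` D"] D by auto
    qed
    have l0: "l b 0 = 0" by (simp add: l_def qvs.representation_zero)
    have lsum: "l b (\<Sum>v\<in>S. of_int (c v) * v) = (\<Sum>v\<in>S. of_int (c v) * l b v)" if "finite S" "S \<subseteq> G" for S
      using that
    proof (induction rule: finite_induct)
      case (insert x S)
      hence "(\<Sum>v\<in>S. of_int (c v) * v) \<in> G" "of_int (c x) * x \<in> G"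
        by (auto intro!: zmod.subspace_sum[OF G] zmod.subspace_scale[OF G])
      with insert show ?case by (simp add: l_add l_scale)
    qed (simp add: l0)
    have "0 = l b (\<Sum>v\<in>T. of_int (c v) * v)" by (simp add: T(3) l0)
    also have "\<dots> = (\<Sum>v\<in>T. of_int (c v) * l b v)" using lsum T UG by blast
    also have "\<dots> = (\<Sum>v\<in>{u b}. of_int (c v) * l b v)"
    proof (rule sum.mono_neutral_right)
      show "\<forall>v\<in>T - {u b}. of_int (c v) * l b v = 0"
      proof
        fix v assume v: "v \<in> T - {u b}"
        then obtain a where a: "a \<in> B" "l a (u a) \<noteq> 0" "v = u a" using T by (auto simp: U_def)
        show "of_int (c v) * l b v = 0"
        proof (cases "c v = 0")
          case False
          hence "a \<in> D" using a v by (auto simp: D_def)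
          hence "idx a \<le> idx b" using b by blast
          moreover have "idx a \<noteq> idx b" using a v inj b by (auto simp: inj_on_def D_def)
          ultimately have "l b v = 0"
            using a u[of a] l_zero[of "u a" "Suc (idx a)" b] by (auto simp: Gn_def)
          thus ?thesis by simp
        qed simp
      qed
    qed (use b T in \<open>auto simp: D_def\<close>)
    also have "\<dots> \<noteq> 0" using b by (simp add: D_def)
    finally show False by simp
  qed
  moreover have "Gn n \<subseteq> zmod.span U" for n
  proof (induction n)
    case 0
    then show ?case by (auto simp: Gn_def Bn_def intro: zmod.span_zero)
  next
    case (Suc n)
    show ?case
    proof
      fix y assume y: "y \<in> Gn (Suc n)"
      show "y \<in> zmod.span U"
      proof (cases "\<exists>b\<in>B. idx b = n")
        case True
        then obtain b where b: "b \<in> B" "idx b = n" by blast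
        obtain k :: int where k: "l b y = of_int k * l b (u b)" using ugen b y by blast
        show ?thesis
        proof (cases "l b (u b) = 0")
          case True
          hence "y \<in> Gn n" using l_kernel[of y b] b y k by simp
          thus ?thesis using Suc by blast
        next
          case False
          hence uU: "u b \<in> U" using b by (auto simp: U_def)
          have uG: "u b \<in> Gn (Suc n)" using u b by blast
          have "y + of_int (- k) * u b \<in> Gn (Suc n)"
            using y uG by (intro zmod.subspace_add[OF GnS] zmod.subspace_scale[OF GnS])
          moreover have "l b (y + of_int (- k) * u b) = 0"
            using l_add[of y "of_int (- k) * u b" b] l_scale[of "u b" b "-k"] k y uG
              zmod.subspace_scale[OF G, of "u b" "-k"] by (simp add: Gn_def)
          ultimately have "y + of_int (- k) * u b \<in> Gn n" using l_kernel b by blast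
          hence "y + of_int (- k) * u b \<in> zmod.span U" using Suc by blast
          hence "(y + of_int (- k) * u b) + of_int k * u b \<in> zmod.span U"
            using zmod.span_add zmod.span_scale[OF zmod.span_base[OF uU]] by blast
          thus ?thesis by simp
        qed
      next
        \<comment> \<open>No basis element has index \<open>n\<close>; this happens when
          \<open>B\<close> is finite.\<close>
        case False
        hence "Bn (Suc n) = Bn n" by (auto simp: Bn_def less_Suc_eq)
        thus ?thesis using Suc y by (auto simp: Gn_def)
      qed
    qed
  qed
  moreover have "G \<subseteq> (\<Union>n. Gn n)"
  proof
    fix y assume y: "y \<in> G"
    then obtain S r where S: "finite S" "S \<subseteq> B" "y = (\<Sum>a\<in>S. of_rat (r a) * a)"
      using mem unfolding qvs.span_explicit by blast
    have "S \<subseteq> Bn (Suc (Max (idx ` S)))" using S by (auto simp: Bn_def less_Suc_eq_le)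
    hence "y \<in> qvs.span (Bn (Suc (Max (idx ` S))))"
      unfolding S(3) by (intro qvs.span_sum qvs.span_scale qvs.span_base) auto
    thus "y \<in> (\<Union>n. Gn n)" using y by (auto simp: Gn_def)
  qed
  ultimately show ?thesis by (intro that[OF UG]) (assumption, blast)
qed

section \<open>Primitive polynomials\<close>

lemma lookup_of_int_mult:
  fixes f :: "'m::comm_monoid_add \<Rightarrow>\<^sub>0 int"
  shows "Poly_Mapping.lookup (of_int k * f) m = k * Poly_Mapping.lookup f m"
proof -
  have "of_int k * f = Poly_Mapping.map ((*) k) f"
  proof -
    have "(Poly_Mapping.single 0 (of_int k :: int) :: 'm \<Rightarrow>\<^sub>0 int) = of_int k" by (rule single_of_int)
    thus ?thesis unfolding mult_map_scale_conv_mult by simp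
  qed
  thus ?thesis by (simp add: Poly_Mapping.map.rep_eq when_def)
qed

lemma of_int_dvd_iff_lookup:
  fixes f :: "'m::comm_monoid_add \<Rightarrow>\<^sub>0 int"
  shows "of_int k dvd f \<longleftrightarrow> (\<forall>m. k dvd Poly_Mapping.lookup f m)"
proof
  assume "of_int k dvd f"
  thus "\<forall>m. k dvd Poly_Mapping.lookup f m" by (auto simp: dvd_def lookup_of_int_mult)
next
  assume k: "\<forall>m. k dvd Poly_Mapping.lookup f m"
  have "f = of_int k * Poly_Mapping.map (\<lambda>c. c div k) f"
    by (rule poly_mapping_eqI)
      (use k in \<open>auto simp: lookup_of_int_mult Poly_Mapping.map.rep_eq when_def\<close>)
  thus "of_int k dvd f" by (metis dvd_triv_left)
qed

text \<open>Only the pair \<open>a\<close>, \<open>b\<close> contributes to the coefficient at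
  \<open>a + b\<close>: a smaller monomial in one factor would need one above the bound in the
  other.\<close>

lemma lookup_mult_top:
  fixes f g :: "'m::{ordered_cancel_comm_monoid_add, linorder} \<Rightarrow>\<^sub>0 int"
  assumes f: "\<And>m. m \<in> Poly_Mapping.keys f \<Longrightarrow> m \<le> a" and g: "\<And>m. m \<in> Poly_Mapping.keys g \<Longrightarrow> m \<le> b"
  shows "Poly_Mapping.lookup (f * g) (a + b) = Poly_Mapping.lookup f a * Poly_Mapping.lookup g b"
proof -
  have zero: "Poly_Mapping.lookup f l * (\<Sum>q. Poly_Mapping.lookup g q when a + b = l + q) = 0" if "l \<noteq> a" for l
  proof (cases "l \<in> Poly_Mapping.keys f")
    case True
    hence "l < a" using f that by force
    have "(Poly_Mapping.lookup g q when a + b = l + q) = 0" for q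
    proof (cases "q \<in> Poly_Mapping.keys g")
      case True
      hence "l + q < a + b" using g \<open>l < a\<close> by (simp add: add_less_le_mono)
      thus ?thesis by auto
    qed (simp add: in_keys_iff)
    thus ?thesis by simp
  qed (simp add: in_keys_iff)
  have "Poly_Mapping.lookup (f * g) (a + b)
      = (\<Sum>l. (Poly_Mapping.lookup f l * (\<Sum>q. Poly_Mapping.lookup g q when a + b = l + q)) when l = a)"
    unfolding lookup_mult by (rule Sum_any.cong) (use zero in \<open>auto simp: when_def\<close>)
  also have "\<dots> = Poly_Mapping.lookup f a * Poly_Mapping.lookup g b"
    by simp
  finally show ?thesis .
qed

text \<open>Reduction modulo \<open>p\<close> without leaving the integers: \<open>r\<close> drops
  the coefficients divisible by \<open>p\<close>. If \<open>p\<close> divided neither factor, the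
  leading coefficients of the reduced factors would be prime to \<open>p\<close>, and so would their
  product, a coefficient of the product of the reduced factors.\<close>

lemma prime_dvd_poly_mult:
  fixes f g :: "'m::{ordered_cancel_comm_monoid_add, linorder} \<Rightarrow>\<^sub>0 int"
  assumes p: "Factorial_Ring.prime p" and dvd: "of_int p dvd f * g"
  shows "of_int p dvd f \<or> of_int p dvd g"
proof (rule ccontr)
  define r where "r h = Poly_Mapping.map (\<lambda>c. if p dvd c then 0 else c) h" for h :: "'m \<Rightarrow>\<^sub>0 int"
  have r: "Poly_Mapping.lookup (r h) m =
      (if p dvd Poly_Mapping.lookup h m then 0 else Poly_Mapping.lookup h m)" for h m
    by (simp add: r_def Poly_Mapping.map.rep_eq when_def)
  have rdvd: "of_int p dvd h - r h" for h
    by (simp add: of_int_dvd_iff_lookup lookup_minus r)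
  have top: "\<exists>a. \<not> p dvd Poly_Mapping.lookup (r h) a \<and> (\<forall>m\<in>Poly_Mapping.keys (r h). m \<le> a)"
    if "\<not> of_int p dvd h" for h
  proof -
    from that obtain m where "\<not> p dvd Poly_Mapping.lookup h m"
      by (auto simp: of_int_dvd_iff_lookup)
    hence "m \<in> Poly_Mapping.keys (r h)" by (auto simp: in_keys_iff r)
    hence "Poly_Mapping.keys (r h) \<noteq> {}" by auto
    hence "Max (Poly_Mapping.keys (r h)) \<in> Poly_Mapping.keys (r h)" by simp
    thus ?thesis
      by (intro exI[of _ "Max (Poly_Mapping.keys (r h))"]) (auto simp: in_keys_iff r split: if_splits)
  qed
  assume "\<not> (of_int p dvd f \<or> of_int p dvd g)"
  then obtain a b where a: "\<not> p dvd Poly_Mapping.lookup (r f) a" "\<forall>m\<in>Poly_Mapping.keys (r f). m \<le> a"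
    and b: "\<not> p dvd Poly_Mapping.lookup (r g) b" "\<forall>m\<in>Poly_Mapping.keys (r g). m \<le> b"
    using top by metis
  have "r f * r g = f * g - (f - r f) * g - r f * (g - r g)" by (simp add: algebra_simps)
  hence "of_int p dvd r f * r g" using dvd rdvd by (metis dvd_diff dvd_mult dvd_mult2)
  hence "p dvd Poly_Mapping.lookup (r f * r g) (a + b)" by (simp add: of_int_dvd_iff_lookup)
  hence "p dvd Poly_Mapping.lookup (r f) a * Poly_Mapping.lookup (r g) b"
    using lookup_mult_top[of "r f" a "r g" b] a b by simp
  thus False using a b p by (simp add: prime_dvd_mult_iff)
qed

text \<open>
  For polynomials these are the primitive ones, by Gauss' lemma; in this form closure under products
  and cancellation of denominators are immediate.
\<close>
definition int_pure :: "'r::comm_ring_1 \<Rightarrow> bool"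
  where "int_pure g \<longleftrightarrow> g \<noteq> 0 \<and> (\<forall>(k::int) f. of_int k dvd g * f \<longrightarrow> of_int k dvd f)"

lemma int_pureD: "int_pure g \<Longrightarrow> of_int k dvd g * f \<Longrightarrow> of_int k dvd f"
  unfolding int_pure_def by blast

lemma int_pure_nonzero: "int_pure g \<Longrightarrow> g \<noteq> 0"
  by (auto simp: int_pure_def)

lemma int_pure_one [simp]: "int_pure (1::'r::comm_ring_1)"
  by (auto simp: int_pure_def)

lemma int_pure_mult:
  fixes g h :: "'r::idom"
  shows "int_pure g \<Longrightarrow> int_pure h \<Longrightarrow> int_pure (g * h)"
  unfolding int_pure_def by (metis mult.assoc no_zero_divisors)

text \<open>The prime factors of \<open>k\<close> are cancelled one at a time: each divides the
  product, hence divides \<open>f\<close> because it does not divide \<open>g\<close>.\<close>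

lemma int_pureI_prime:
  fixes g :: "'m::{ordered_cancel_comm_monoid_add, linorder} \<Rightarrow>\<^sub>0 int"
  assumes "g \<noteq> 0" and pr: "\<And>p. Factorial_Ring.prime p \<Longrightarrow> \<not> of_int p dvd g"
  shows "int_pure g"
proof -
  have "of_int k dvd g * f \<longrightarrow> of_int k dvd f" for k f
  proof (induction k arbitrary: f rule: prime_divisors_induct)
    case zero
    then show ?case using \<open>g \<noteq> 0\<close> by simp
  next
    case (unit k)
    then obtain j where "1 = k * j" by (auto simp: dvd_def)
    hence "(1 :: 'm \<Rightarrow>\<^sub>0 int) = of_int k * of_int j" by (metis of_int_1 of_int_mult)
    hence "(of_int k :: 'm \<Rightarrow>\<^sub>0 int) dvd 1" by (rule dvdI)
    then show ?case using dvd_trans[OF _ one_dvd] by blast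
  next
    case (factor p k)
    show ?case
    proof
      assume *: "of_int (p * k) dvd g * f"
      hence "of_int p dvd g * f" by (metis dvd_mult_left of_int_mult)
      hence "of_int p dvd f" using prime_dvd_poly_mult[OF factor(1)] pr[OF factor(1)] by blast
      then obtain f' where f': "f = of_int p * f'" by (auto simp: dvd_def)
      from factor(1) have "p \<noteq> 0" by auto
      hence "(of_int p :: 'm \<Rightarrow>\<^sub>0 int) \<noteq> 0" by simp
      moreover have "of_int p * of_int k dvd of_int p * (g * f')"
        using * by (simp add: f' algebra_simps)
      ultimately have "of_int k dvd g * f'" by (metis dvd_mult_cancel_left)
      hence "of_int k dvd f'" using factor by blast
      thus "of_int (p * k) dvd f" by (simp add: f' mult_dvd_mono)
    qed
  qed
  thus ?thesis using \<open>g \<noteq> 0\<close> unfolding int_pure_def by blast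
qed

text \<open>The gcd of the coefficients is split off. The clause on \<open>keys\<close> keeps the
  primitive part in the same indeterminates, so that it may serve as a denominator in the same
  localization.\<close>

lemma content_decomposition:
  fixes f :: "'m::{ordered_cancel_comm_monoid_add, linorder} \<Rightarrow>\<^sub>0 int"
  assumes "f \<noteq> 0"
  obtains n g where "n \<noteq> 0" "f = of_int n * g" "int_pure g" "Poly_Mapping.keys g = Poly_Mapping.keys f"
proof -
  define n where "n = Gcd (Poly_Mapping.lookup f ` Poly_Mapping.keys f)"
  have ndvd: "n dvd Poly_Mapping.lookup f m" for m
    by (cases "m \<in> Poly_Mapping.keys f") (auto simp: n_def in_keys_iff)
  hence "of_int n dvd f" by (simp add: of_int_dvd_iff_lookup)
  then obtain g where g: "f = of_int n * g" by (auto simp: dvd_def)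
  have "n \<noteq> 0" using \<open>f \<noteq> 0\<close> g by auto
  have "\<not> of_int p dvd g" if "Factorial_Ring.prime p" for p
  proof
    assume "of_int p dvd g"
    hence "of_int (n * p) dvd f" by (simp add: g)
    hence "n * p dvd Gcd (Poly_Mapping.lookup f ` Poly_Mapping.keys f)"
      by (intro Gcd_greatest) (auto simp only: of_int_dvd_iff_lookup)
    hence "n * p dvd n * 1" by (simp add: n_def)
    hence "p dvd 1" using \<open>n \<noteq> 0\<close> by (simp only: dvd_mult_cancel_left) auto
    thus False using that by auto
  qed
  moreover have "g \<noteq> 0" using \<open>f \<noteq> 0\<close> g by auto
  ultimately have "int_pure g" by (rule int_pureI_prime[rotated])
  moreover have "Poly_Mapping.keys g = Poly_Mapping.keys f"
    using \<open>n \<noteq> 0\<close> by (auto simp: in_keys_iff g lookup_of_int_mult)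
  ultimately show ?thesis using that g \<open>n \<noteq> 0\<close> by blast
qed

section \<open>Localization at the primitive polynomials\<close>

text \<open>Characteristic zero makes the fraction field a rational vector space, in which the rank
  condition of Pontryagin's criterion is stated.\<close>

instance fract :: ("{idom,ring_char_0}") field_char_0
proof
  show "inj (of_nat :: nat \<Rightarrow> 'a fract)"
    by (rule injI) (simp add: of_nat_fract eq_fract)
qed

lemma to_fract_of_int [simp]: "to_fract (of_int k) = of_int k"
proof -
  have nat: "to_fract (of_nat n) = of_nat n" for n :: nat
    by (induction n) simp_all
  show ?thesis
    by (cases k rule: int_cases2) (simp_all add: nat)
qed

type_synonym 'v mpoly = "('v \<Rightarrow>\<^sub>0 nat) \<Rightarrow>\<^sub>0 int"

lemma mpoly_expansion:
  fixes f :: "'m::comm_monoid_add \<Rightarrow>\<^sub>0 int"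
  shows "f = (\<Sum>m\<in>Poly_Mapping.keys f. of_int (Poly_Mapping.lookup f m) * Poly_Mapping.single m 1)"
  by (rule poly_mapping_eqI)
    (auto simp: lookup_sum lookup_of_int_mult lookup_single when_def in_keys_iff
        if_distrib[of "\<lambda>x. _ * x"] cong: if_cong)

lemma keys_of_int_mult:
  fixes f :: "'m::comm_monoid_add \<Rightarrow>\<^sub>0 int"
  shows "Poly_Mapping.keys (of_int k * f) \<subseteq> Poly_Mapping.keys f"
  by (auto simp: in_keys_iff lookup_of_int_mult)

lemma mpoly_induct [case_names zero single add]:
  fixes f :: "'m \<Rightarrow>\<^sub>0 'c::comm_monoid_add"
  assumes "P 0" "\<And>m c. P (Poly_Mapping.single m c)" "\<And>f g. P f \<Longrightarrow> P g \<Longrightarrow> P (f + g)"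
  shows "P f"
proof (induction f rule: update_induct)
  case const
  show ?case by (rule assms(1))
next
  case (update f a b)
  have "Poly_Mapping.update a b f = f + Poly_Mapping.single a b"
    by (rule poly_mapping_eqI)
      (use update in \<open>auto simp: lookup_update lookup_add lookup_single when_def in_keys_iff\<close>)
  thus ?case using update assms by simp
qed

definition polys_on :: "'v set \<Rightarrow> 'v mpoly set"
  where "polys_on J = {f. \<forall>m\<in>Poly_Mapping.keys f. Poly_Mapping.keys m \<subseteq> J}"

lemma polys_on_mono: "J \<subseteq> K \<Longrightarrow> polys_on J \<subseteq> polys_on K"
  by (auto simp: polys_on_def)

lemma polys_on_add: "f \<in> polys_on J \<Longrightarrow> g \<in> polys_on J \<Longrightarrow> f + g \<in> polys_on J"
  using keys_add[of f g] by (auto simp: polys_on_def)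

lemma polys_on_mult: 
  assumes "f \<in> polys_on J" "g \<in> polys_on J" shows "f * g \<in> polys_on J"
proof -
  have "Poly_Mapping.keys m \<subseteq> J" if m: "m \<in> Poly_Mapping.keys (f * g)" for m
  proof -
    obtain a b where ab: "m = a + b" "a \<in> Poly_Mapping.keys f" "b \<in> Poly_Mapping.keys g"
      using keys_mult[of f g] m by blast
    have "Poly_Mapping.keys m \<subseteq> Poly_Mapping.keys a \<union> Poly_Mapping.keys b"
      unfolding ab(1) by (rule keys_add)
    with ab assms show ?thesis unfolding polys_on_def by blast
  qed
  thus ?thesis by (simp add: polys_on_def)
qed

lemma polys_on_of_int [simp]: "of_int k \<in> polys_on J"
proof -
  have "(of_int k :: 'a mpoly) = Poly_Mapping.single 0 k"
    using single_of_int[of k, where 'b = int and 'a = "'a \<Rightarrow>\<^sub>0 nat"] by simp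
  thus ?thesis by (simp add: polys_on_def)
qed

lemma polys_on_one [simp]: "1 \<in> polys_on J"
  using polys_on_of_int[of 1 J] by simp

lemma polys_on_finite_support:
  assumes "f \<in> polys_on J"
  obtains K where "finite K" "K \<subseteq> J" "f \<in> polys_on K"
proof
  show "finite (\<Union>m\<in>Poly_Mapping.keys f. Poly_Mapping.keys m)" by simp
  show "(\<Union>m\<in>Poly_Mapping.keys f. Poly_Mapping.keys m) \<subseteq> J"
    using assms by (auto simp: polys_on_def)
qed (auto simp: polys_on_def)

text \<open>The localization of \<open>\<int>[J]\<close> at the multiplicative set of primitive polynomials.\<close>
definition nagata :: "'v::linorder set \<Rightarrow> 'v mpoly fract set"
  where "nagata J = {to_fract f / to_fract g | f g. f \<in> polys_on J \<and> g \<in> polys_on J \<and> int_pure g}"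

lemma nagataI:
  "f \<in> polys_on J \<Longrightarrow> g \<in> polys_on J \<Longrightarrow> int_pure g \<Longrightarrow> to_fract f / to_fract g \<in> nagata J"
  unfolding nagata_def by blast

lemma nagataE:
  assumes "y \<in> nagata J"
  obtains f g where "f \<in> polys_on J" "g \<in> polys_on J" "int_pure g" "g \<noteq> 0" "y = to_fract f / to_fract g"
  using assms int_pure_nonzero unfolding nagata_def by blast

lemma nagata_mono: "J \<subseteq> K \<Longrightarrow> nagata J \<subseteq> nagata K"
  using polys_on_mono unfolding nagata_def by blast

lemma nagata_add:
  assumes "x \<in> nagata J" "y \<in> nagata J" shows "x + y \<in> nagata J"
proof -
  obtain a b c d where abcd: "a \<in> polys_on J" "b \<in> polys_on J" "int_pure b" "b \<noteq> 0" "x = to_fract a / to_fract b"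
    "c \<in> polys_on J" "d \<in> polys_on J" "int_pure d" "d \<noteq> 0" "y = to_fract c / to_fract d"
    using assms by (metis nagataE)
  hence "x + y = to_fract (a * d + c * b) / to_fract (b * d)" by (simp add: field_simps)
  thus ?thesis using abcd by (simp only:) (intro nagataI polys_on_add polys_on_mult int_pure_mult)
qed

lemma nagata_mult:
  assumes "x \<in> nagata J" "y \<in> nagata J" shows "x * y \<in> nagata J"
proof -
  obtain a b c d where abcd: "a \<in> polys_on J" "b \<in> polys_on J" "int_pure b" "b \<noteq> 0" "x = to_fract a / to_fract b"
    "c \<in> polys_on J" "d \<in> polys_on J" "int_pure d" "d \<noteq> 0" "y = to_fract c / to_fract d"
    using assms by (metis nagataE)
  hence "x * y = to_fract (a * c) / to_fract (b * d)" by (simp add: field_simps)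
  thus ?thesis using abcd by (simp only:) (intro nagataI polys_on_mult int_pure_mult)
qed

lemma nagata_of_int [simp]: "of_int k \<in> nagata J"
  using nagataI[OF polys_on_of_int[of k J] polys_on_one] by simp

lemma nagata_one [simp]: "1 \<in> nagata J"
  using nagata_of_int[of 1 J] by simp

lemma subspace_nagata: "zmod.subspace (nagata J)"
  using nagata_of_int[of 0 J] by (intro zmod.subspaceI) (auto intro: nagata_add nagata_mult)

lemma nagata_finite_support:
  assumes "y \<in> nagata J"
  obtains K where "finite K" "K \<subseteq> J" "y \<in> nagata K"
proof -
  obtain f g where fg: "f \<in> polys_on J" "g \<in> polys_on J" "int_pure g" "y = to_fract f / to_fract g"
    using assms by (rule nagataE)
  obtain A B where "finite A" "A \<subseteq> J" "f \<in> polys_on A" "finite B" "B \<subseteq> J" "g \<in> polys_on B"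
    using fg polys_on_finite_support by metis
  hence "finite (A \<union> B)" "A \<union> B \<subseteq> J" "f \<in> polys_on (A \<union> B)" "g \<in> polys_on (A \<union> B)"
    using polys_on_mono[of A "A \<union> B"] polys_on_mono[of B "A \<union> B"] by auto
  with fg show ?thesis using that nagataI by blast
qed

text \<open>Once the content is split off the numerator, a quotient of two primitive polynomials
  remains, and its inverse is a fraction of the same kind.\<close>

lemma nagata_int_times_unit:
  assumes "y \<in> nagata J" "y \<noteq> 0"
  obtains n u where "n \<noteq> 0" "y = of_int n * u" "u \<in> nagata J" "inverse u \<in> nagata J" "u \<noteq> 0"
proof -
  obtain f g where fg: "f \<in> polys_on J" "g \<in> polys_on J" "int_pure g" "y = to_fract f / to_fract g"
    using assms by (metis nagataE)
  with assms have "f \<noteq> 0" by auto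
  then obtain n h where h: "n \<noteq> 0" "f = of_int n * h" "int_pure h" "Poly_Mapping.keys h = Poly_Mapping.keys f"
    by (rule content_decomposition)
  have hJ: "h \<in> polys_on J" using fg h by (simp add: polys_on_def)
  show ?thesis
  proof (rule that[of n "to_fract h / to_fract g"])
    show "y = of_int n * (to_fract h / to_fract g)" by (simp add: fg h)
    show "inverse (to_fract h / to_fract g) \<in> nagata J"
      using nagataI[OF fg(2) hJ h(3)] by simp
  qed (use fg h hJ int_pure_nonzero nagataI in auto)
qed

lemma nagata_common_denominator:
  assumes "finite B" "B \<subseteq> nagata J"
  obtains g where "int_pure g" "\<And>b. b \<in> B \<Longrightarrow> \<exists>f. b = to_fract f / to_fract g"
proof -
  have "\<exists>g. int_pure g \<and> (\<forall>b\<in>B. \<exists>f. b = to_fract f / to_fract g)"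
    using assms
  proof (induction B rule: finite_induct)
    case empty
    show ?case by (intro exI[of _ 1]) simp
  next
    case (insert b B)
    then obtain g where g: "int_pure g" "\<forall>b\<in>B. \<exists>f. b = to_fract f / to_fract g" by auto
    obtain p q where pq: "int_pure q" "q \<noteq> 0" "b = to_fract p / to_fract q"
      using insert by (metis insert_subset nagataE)
    have "g \<noteq> 0" using g by (simp add: int_pure_nonzero)
    have "\<exists>f. c = to_fract f / to_fract (g * q)" if c: "c \<in> insert b B" for c
    proof (cases "c = b")
      case True
      thus ?thesis using pq \<open>g \<noteq> 0\<close> by (intro exI[of _ "p * g"]) simp
    next
      case False
      then obtain f where "c = to_fract f / to_fract g" using c g by blast
      thus ?thesis using pq \<open>g \<noteq> 0\<close> by (intro exI[of _ "f * q"]) simp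
    qed
    thus ?case using g pq int_pure_mult by blast
  qed
  thus ?thesis using that by blast
qed

text \<open>This is the finiteness condition of Pontryagin's criterion. With a common denominator
  \<open>g\<close> for \<open>B\<close>, every element of the rational span is, up to an integer
  factor, a fraction over \<open>g\<close> whose numerator uses the finitely many monomials in
  \<open>M\<close>. For elements of the localization the integer factor cancels, so the monomials
  divided by \<open>g\<close> generate.\<close>

lemma nagata_finite_rank:
  assumes "finite B" "B \<subseteq> nagata J"
  shows "\<exists>T. finite T \<and> nagata J \<inter> qvs.span B \<subseteq> zmod.span T"
proof -
  obtain g where g: "int_pure g" "\<And>b. b \<in> B \<Longrightarrow> \<exists>f. b = to_fract f / to_fract g"
    using nagata_common_denominator[OF assms] by blast
  then obtain num where num: "\<And>b. b \<in> B \<Longrightarrow> b = to_fract (num b) / to_fract g" by metis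
  have "g \<noteq> 0" using g by (simp add: int_pure_nonzero)
  define M where "M = (\<Union>b\<in>B. Poly_Mapping.keys (num b))"
  define T where "T = (\<lambda>m. to_fract (Poly_Mapping.single m 1) / to_fract g) ` M"
  define W where "W = {y. \<exists>n f. n \<noteq> 0 \<and> Poly_Mapping.keys f \<subseteq> M \<and> of_int n * y = to_fract f / to_fract g}"
  have "qvs.subspace W"
  proof (rule qvs.subspaceI)
    show "0 \<in> W" unfolding W_def by (rule CollectI, rule exI[of _ 1], rule exI[of _ 0]) simp
  next
    fix x y assume "x \<in> W" "y \<in> W"
    then obtain n m f h where *: "n \<noteq> 0" "Poly_Mapping.keys f \<subseteq> M" "of_int n * x = to_fract f / to_fract g"
      "m \<noteq> 0" "Poly_Mapping.keys h \<subseteq> M" "of_int m * y = to_fract h / to_fract g"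
      unfolding W_def by blast
    have "of_int (n * m) * (x + y) = of_int m * (of_int n * x) + of_int n * (of_int m * y)"
      by (simp add: algebra_simps)
    also have "\<dots> = to_fract (of_int m * f + of_int n * h) / to_fract g"
      unfolding * by (simp add: add_divide_distrib)
    finally have "of_int (n * m) * (x + y) = to_fract (of_int m * f + of_int n * h) / to_fract g" .
    moreover have "Poly_Mapping.keys (of_int m * f + of_int n * h) \<subseteq> M"
      using *(2,5) keys_add[of "of_int m * f" "of_int n * h"] keys_of_int_mult by blast
    moreover have "n * m \<noteq> 0" using * by simp
    ultimately show "x + y \<in> W" unfolding W_def by blast
  next
    fix c :: rat and x assume "x \<in> W"
    then obtain n f where *: "n \<noteq> 0" "Poly_Mapping.keys f \<subseteq> M" "of_int n * x = to_fract f / to_fract g"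
      unfolding W_def by blast
    obtain p q where pq: "c = of_int p / of_int q" "q \<noteq> 0"
      by (metis Rat_cases Fract_of_int_quotient less_irrefl)
    have "of_int (n * q) * (of_rat c * x) = of_int p * (of_int n * x)"
      using pq by (simp add: of_rat_divide)
    also have "\<dots> = to_fract (of_int p * f) / to_fract g" unfolding * by simp
    finally have "of_int (n * q) * (of_rat c * x) = to_fract (of_int p * f) / to_fract g" .
    moreover have "Poly_Mapping.keys (of_int p * f) \<subseteq> M"
      using *(2) keys_of_int_mult by blast
    moreover have "n * q \<noteq> 0" using * pq by simp
    ultimately show "of_rat c * x \<in> W" unfolding W_def by blast
  qed
  moreover have "B \<subseteq> W"
  proof
    fix b assume b: "b \<in> B"
    have "of_int 1 * b = to_fract (num b) / to_fract g" using num[OF b] by simp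
    moreover have "Poly_Mapping.keys (num b) \<subseteq> M" using b by (auto simp: M_def)
    ultimately show "b \<in> W" unfolding W_def using one_neq_zero by blast
  qed
  ultimately have span: "qvs.span B \<subseteq> W" by (intro qvs.span_minimal)
  have "y \<in> zmod.span T" if y: "y \<in> nagata J" "y \<in> W" for y
  proof -
    obtain h d where hd: "int_pure d" "d \<noteq> 0" "y = to_fract h / to_fract d"
      using y by (metis nagataE)
    obtain n f where nf: "n \<noteq> 0" "Poly_Mapping.keys f \<subseteq> M" "of_int n * y = to_fract f / to_fract g"
      using y unfolding W_def by blast
    have "to_fract (of_int n * h * g) = to_fract (d * f)"
      using nf(3) hd \<open>g \<noteq> 0\<close> by (simp add: field_simps)
    \<comment> \<open>The purity of the denominator \<open>d\<close> of \<open>y\<close> is what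
      makes \<open>n\<close> divide \<open>f\<close> and so cancel.\<close>
    hence "d * f = of_int n * (h * g)" by (simp only: to_fract_eq_iff mult.assoc)
    hence "of_int n dvd f" using int_pureD[OF hd(1)] by (metis dvd_triv_left)
    then obtain k where k: "f = of_int n * k" by (auto simp: dvd_def)
    have "Poly_Mapping.keys k \<subseteq> M"
      using nf by (auto simp: k in_keys_iff lookup_of_int_mult)
    have "of_int n * y = of_int n * (to_fract k / to_fract g)" using nf by (simp add: k)
    hence "y = to_fract k / to_fract g" using \<open>n \<noteq> 0\<close> by (metis mult_left_cancel of_int_eq_0_iff)
    also have "\<dots> = (\<Sum>m\<in>Poly_Mapping.keys k. of_int (Poly_Mapping.lookup k m) *
        (to_fract (Poly_Mapping.single m 1) / to_fract g))"
      by (subst mpoly_expansion[of k]) (simp add: sum_divide_distrib)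
    also have "\<dots> \<in> zmod.span T"
      using \<open>Poly_Mapping.keys k \<subseteq> M\<close>
      by (intro zmod.span_sum zmod.span_scale zmod.span_base) (auto simp: T_def)
    finally show ?thesis .
  qed
  moreover have "finite T" using \<open>finite B\<close> by (simp add: T_def M_def)
  ultimately show ?thesis using span by blast
qed

section \<open>Permuting indeterminates\<close>

text \<open>\<open>map_key\<close> precomposes with an injective function. For an involution,
  precomposing with \<open>\<pi>\<close> and renaming along \<open>\<pi>\<close> are the
  same.\<close>

definition swap_poly :: "('v \<Rightarrow> 'v) \<Rightarrow> 'v mpoly \<Rightarrow> 'v mpoly"
  where "swap_poly \<pi> = Poly_Mapping.map_key (Poly_Mapping.map_key \<pi>)"

text \<open>Independent of the chosen fraction only when \<open>\<pi>\<close> is an involution.\<close>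
definition swap :: "('v \<Rightarrow> 'v) \<Rightarrow> 'v::linorder mpoly fract \<Rightarrow> 'v mpoly fract"
  where "swap \<pi> y = (THE z. \<forall>f g. g \<noteq> 0 \<longrightarrow> y = to_fract f / to_fract g \<longrightarrow>
     z = to_fract (swap_poly \<pi> f) / to_fract (swap_poly \<pi> g))"

context
  fixes \<pi> :: "'v::linorder \<Rightarrow> 'v"
  assumes invol: "\<And>v. \<pi> (\<pi> v) = v"
begin

lemma inj_invol: "inj \<pi>"
  by (metis injI invol)

lemma lookup_map_key_invol:
  "Poly_Mapping.lookup (Poly_Mapping.map_key \<pi> m) v = Poly_Mapping.lookup m (\<pi> v)"
  by (simp add: map_key.rep_eq inj_invol)

lemma map_key_invol [simp]: "Poly_Mapping.map_key \<pi> (Poly_Mapping.map_key \<pi> m) = m"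
  by (rule poly_mapping_eqI) (simp add: lookup_map_key_invol invol)

lemma inj_map_key: "inj (Poly_Mapping.map_key \<pi> :: ('v \<Rightarrow>\<^sub>0 nat) \<Rightarrow> _)"
  by (metis injI map_key_invol)

lemma lookup_swap_poly:
  "Poly_Mapping.lookup (swap_poly \<pi> f) m = Poly_Mapping.lookup f (Poly_Mapping.map_key \<pi> m)"
  by (simp add: swap_poly_def map_key.rep_eq inj_map_key)

lemma swap_poly_swap_poly [simp]: "swap_poly \<pi> (swap_poly \<pi> f) = f"
  by (rule poly_mapping_eqI) (simp add: lookup_swap_poly)

lemma swap_poly_zero [simp]: "swap_poly \<pi> 0 = 0"
  by (rule poly_mapping_eqI) (simp add: lookup_swap_poly)

lemma swap_poly_eq_0_iff [simp]: "swap_poly \<pi> f = 0 \<longleftrightarrow> f = 0"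
  by (metis swap_poly_swap_poly swap_poly_zero)

lemma swap_poly_add: "swap_poly \<pi> (f + g) = swap_poly \<pi> f + swap_poly \<pi> g"
  by (rule poly_mapping_eqI) (simp add: lookup_swap_poly lookup_add)

lemma swap_poly_single:
  "swap_poly \<pi> (Poly_Mapping.single m c) = Poly_Mapping.single (Poly_Mapping.map_key \<pi> m) c"
  by (rule poly_mapping_eqI) (auto simp: lookup_swap_poly lookup_single when_def)

lemma swap_poly_mult: "swap_poly \<pi> (f * g) = swap_poly \<pi> f * swap_poly \<pi> g"
proof (induction f rule: mpoly_induct)
  case (single a c)
  show ?case
    by (induction g rule: mpoly_induct)
      (simp_all add: mult_single swap_poly_single map_key_plus inj_invol algebra_simps swap_poly_add)
qed (simp_all add: algebra_simps swap_poly_add)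

lemma swap_poly_of_int: "swap_poly \<pi> (of_int k) = of_int k"
proof -
  have "(of_int k :: 'v mpoly) = Poly_Mapping.single 0 k"
    using single_of_int[of k, where 'b = int and 'a = "'v \<Rightarrow>\<^sub>0 nat"] by simp
  moreover have "Poly_Mapping.map_key \<pi> (0 :: 'v \<Rightarrow>\<^sub>0 nat) = 0" by (simp add: inj_invol)
  ultimately show ?thesis by (simp add: swap_poly_single)
qed

text \<open>Purity is phrased by divisibility alone, so it is transported by the ring automorphism
  \<open>swap_poly \<pi>\<close>, which is its own inverse.\<close>

lemma swap_poly_int_pure:
  assumes "int_pure f" shows "int_pure (swap_poly \<pi> f)"
  unfolding int_pure_def
proof (intro conjI allI impI)
  show "swap_poly \<pi> f \<noteq> 0" using assms by (simp add: int_pure_nonzero)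
  fix k :: int and h assume "of_int k dvd swap_poly \<pi> f * h"
  then obtain d where "swap_poly \<pi> f * h = of_int k * d" by (auto simp: dvd_def)
  hence "swap_poly \<pi> (swap_poly \<pi> f * h) = swap_poly \<pi> (of_int k * d)" by simp
  hence "f * swap_poly \<pi> h = of_int k * swap_poly \<pi> d"
    by (simp add: swap_poly_mult swap_poly_of_int)
  hence "of_int k dvd swap_poly \<pi> h" using int_pureD[OF assms] by (metis dvd_triv_left)
  then obtain e where "swap_poly \<pi> h = of_int k * e" by (auto simp: dvd_def)
  hence "swap_poly \<pi> (swap_poly \<pi> h) = swap_poly \<pi> (of_int k * e)" by simp
  hence "h = of_int k * swap_poly \<pi> e" by (simp add: swap_poly_mult swap_poly_of_int)
  thus "of_int k dvd h" by simp
qed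

lemma swap_poly_polys_on:
  assumes "f \<in> polys_on J" shows "swap_poly \<pi> f \<in> polys_on (\<pi> ` J)"
proof -
  have "v \<in> \<pi> ` J" if "m \<in> Poly_Mapping.keys (swap_poly \<pi> f)" "v \<in> Poly_Mapping.keys m" for m v
  proof -
    have "Poly_Mapping.map_key \<pi> m \<in> Poly_Mapping.keys f"
      using that by (simp add: in_keys_iff lookup_swap_poly)
    moreover have "\<pi> v \<in> Poly_Mapping.keys (Poly_Mapping.map_key \<pi> m)"
      using that by (simp add: in_keys_iff lookup_map_key_invol invol)
    ultimately have "\<pi> v \<in> J" using assms by (auto simp: polys_on_def)
    thus ?thesis by (metis imageI invol)
  qed
  thus ?thesis by (auto simp: polys_on_def)
qed

lemma swap_poly_fixed:
  assumes f: "f \<in> polys_on J" and fx: "\<And>v. v \<in> J \<Longrightarrow> \<pi> v = v"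
  shows "swap_poly \<pi> f = f"
proof (rule poly_mapping_eqI)
  fix m
  have mk: "Poly_Mapping.map_key \<pi> m = m" if m: "Poly_Mapping.keys m \<subseteq> J" for m :: "'v \<Rightarrow>\<^sub>0 nat"
  proof (rule poly_mapping_eqI)
    fix v
    show "Poly_Mapping.lookup (Poly_Mapping.map_key \<pi> m) v = Poly_Mapping.lookup m v"
    proof (cases "\<pi> v = v")
      case False
      \<comment> \<open>An involution fixing \<open>J\<close> pointwise maps the complement of
        \<open>J\<close> to itself.\<close>
      hence "v \<notin> J" "\<pi> v \<notin> J" using fx by (auto, metis invol)
      hence "Poly_Mapping.lookup m v = 0" "Poly_Mapping.lookup m (\<pi> v) = 0"
        using m by (metis in_keys_iff subsetD)+
      thus ?thesis by (simp add: lookup_map_key_invol)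
    qed (simp add: lookup_map_key_invol)
  qed
  show "Poly_Mapping.lookup (swap_poly \<pi> f) m = Poly_Mapping.lookup f m"
  proof (cases "m \<in> Poly_Mapping.keys f \<or> Poly_Mapping.map_key \<pi> m \<in> Poly_Mapping.keys f")
    case True
    hence "Poly_Mapping.map_key \<pi> m = m" using f mk unfolding polys_on_def by (metis (mono_tags, lifting) map_key_invol mem_Collect_eq)
    thus ?thesis by (simp add: lookup_swap_poly)
  qed (simp add: lookup_swap_poly in_keys_iff)
qed

text \<open>The description in \<open>swap\<close> is well defined because equality of fractions is
  a polynomial identity after cross-multiplication, and \<open>swap_poly\<close> is
  multiplicative.\<close>

lemma swap_fraction:
  assumes "g \<noteq> 0"
  shows "swap \<pi> (to_fract f / to_fract g) = to_fract (swap_poly \<pi> f) / to_fract (swap_poly \<pi> g)"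
  unfolding swap_def
proof (rule the_equality, intro allI impI)
  fix f' g' :: "'v mpoly" assume "g' \<noteq> 0" "to_fract f / to_fract g = to_fract f' / to_fract g'"
  hence "to_fract (f * g') = to_fract (f' * g)" using assms by (simp add: field_simps)
  hence "f * g' = f' * g" by (simp only: to_fract_eq_iff)
  hence "swap_poly \<pi> (f * g') = swap_poly \<pi> (f' * g)" by simp
  hence "to_fract (swap_poly \<pi> f * swap_poly \<pi> g') = to_fract (swap_poly \<pi> f' * swap_poly \<pi> g)"
    by (simp only: swap_poly_mult)
  thus "to_fract (swap_poly \<pi> f) / to_fract (swap_poly \<pi> g) =
      to_fract (swap_poly \<pi> f') / to_fract (swap_poly \<pi> g')"
    using assms \<open>g' \<noteq> 0\<close> by (simp add: field_simps)
qed (use assms in blast)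

lemma fraction_cases:
  fixes y :: "'r::idom fract"
  obtains f g where "g \<noteq> 0" "y = to_fract f / to_fract g"
  by (metis Fract_cases Fract_conv_to_fract)

lemma swap_add: "swap \<pi> (x + y) = swap \<pi> x + swap \<pi> y"
proof -
  obtain a b c d where *: "b \<noteq> 0" "x = to_fract a / to_fract b" "d \<noteq> 0" "y = to_fract c / to_fract d"
    by (metis fraction_cases)
  hence "x + y = to_fract (a * d + c * b) / to_fract (b * d)" by (simp add: field_simps)
  hence "swap \<pi> (x + y) = to_fract (swap_poly \<pi> (a * d + c * b)) / to_fract (swap_poly \<pi> (b * d))"
    using swap_fraction[of "b * d" "a * d + c * b"] * by simp
  also have "\<dots> = swap \<pi> x + swap \<pi> y"
    unfolding *(2,4) swap_fraction[OF *(1)] swap_fraction[OF *(3)] swap_poly_add swap_poly_mult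
    using * by (simp add: field_simps)
  finally show ?thesis .
qed

lemma swap_nagata:
  assumes "y \<in> nagata J" shows "swap \<pi> y \<in> nagata (\<pi> ` J)"
  using assms
  by (elim nagataE) (simp add: swap_fraction nagataI swap_poly_polys_on swap_poly_int_pure)

lemma swap_fixed:
  assumes "y \<in> nagata J" "\<And>v. v \<in> J \<Longrightarrow> \<pi> v = v" shows "swap \<pi> y = y"
  using assms by (elim nagataE) (simp add: swap_fraction swap_poly_fixed)

end

section \<open>Difference operators\<close>

text \<open>Gives the difference operators and renamings access to the general facts on images of
  spans and subspaces.\<close>

lemma module_hom_additive:
  fixes f :: "'a::comm_ring_1 \<Rightarrow> 'b::comm_ring_1"
  assumes add: "\<And>x y. f (x + y) = f x + f y"
  shows "module_hom (\<lambda>(n::int) x. of_int n * x) (\<lambda>(n::int) x. of_int n * x) f"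
proof -
  have zero: "f 0 = 0" using add[of 0 0] by simp
  hence neg: "f (- x) = - f x" for x using add[of x "- x"] by (simp add: eq_neg_iff_add_eq_0 add.commute)
  have nat: "f (of_nat n * x) = of_nat n * f x" for n :: nat and x
    by (induction n) (simp_all add: zero add distrib_right)
  have "f (of_int k * x) = of_int k * f x" for k x
    by (cases k rule: int_cases2) (simp_all add: nat neg)
  thus ?thesis by unfold_locales (simp_all add: add algebra_simps)
qed

text \<open>
  \<open>Main\<close> indeterminates generate the ring, \<open>Twin i\<close> is what the difference operator for \<open>i\<close>
  replaces \<open>Main i\<close> by, and \<open>Spare\<close> ones also belong to the ring and provide fresh names.
\<close>
datatype 'a indet = Main 'a | Twin 'a | Spare nat

text \<open>An arbitrary order. It provides the monomial order behind leading terms.\<close>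

definition indet_order :: "'a indet rel"
  where "indet_order = (SOME r. well_order_on UNIV r)"

lemma linear_order_indet: "linear_order_on UNIV indet_order"
proof -
  have "well_order_on UNIV (indet_order :: 'a indet rel)"
    unfolding indet_order_def using someI_ex[OF well_order_on] .
  thus ?thesis by (simp add: well_order_on_def)
qed

instantiation indet :: (type) linorder
begin

definition "x \<le> y \<longleftrightarrow> (x, y) \<in> indet_order" for x y :: "'a indet"
definition "x < y \<longleftrightarrow> x \<le> y \<and> x \<noteq> y" for x y :: "'a indet"

instance
proof
  note lin = linear_order_indet[where 'a = 'a, unfolded linear_order_on_def partial_order_on_def preorder_on_def]
  fix x y z :: "'a indet"
  show "x \<le> x" using lin by (auto simp: less_eq_indet_def refl_on_def)
  show "x \<le> y \<Longrightarrow> y \<le> z \<Longrightarrow> x \<le> z" using lin by (auto simp: less_eq_indet_def elim: transE)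
  show anti: "x \<le> y \<Longrightarrow> y \<le> x \<Longrightarrow> x = y" using lin by (auto simp: less_eq_indet_def elim: antisymD)
  show "x \<le> y \<or> y \<le> x" using lin \<open>x \<le> x\<close> by (cases "x = y") (auto simp: less_eq_indet_def total_on_def)
  show "x < y \<longleftrightarrow> x \<le> y \<and> \<not> y \<le> x" using anti by (auto simp: less_indet_def \<open>x \<le> x\<close>)
qed

end

type_synonym 'a ratfun = "'a indet mpoly fract"

text \<open>A transposition instead of the substitution of \<open>Twin i\<close> for
  \<open>Main i\<close>: both agree on elements free of \<open>Twin i\<close>, and
  \<open>swap\<close> calls for an involution.\<close>

definition twin :: "'a \<Rightarrow> 'a indet \<Rightarrow> 'a indet"
  where "twin i v = (if v = Main i then Twin i else if v = Twin i then Main i else v)"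

lemma twin_twin [simp]: "twin i (twin i v) = v"
  by (simp add: twin_def)

text \<open>The list fixes the order of the factors \<open>1 - \<sigma>\<^sub>i\<close>, the last
  entry acting first.\<close>

fun diff_op :: "'a list \<Rightarrow> 'a ratfun \<Rightarrow> 'a ratfun" where
  "diff_op [] y = y"
| "diff_op (i # l) y = diff_op l y - swap (twin i) (diff_op l y)"

lemma diff_op_add: "diff_op l (x + y) = diff_op l x + diff_op l y"
  by (induction l) (simp_all add: swap_add)

interpretation diff_op: module_hom "\<lambda>(n::int) x. of_int n * x" "\<lambda>(n::int) x. of_int n * x" "diff_op l"
  by (rule module_hom_additive) (rule diff_op_add)

lemma diff_op_nagata:
  assumes "y \<in> nagata M" shows "diff_op l y \<in> nagata (M \<union> Main ` set l \<union> Twin ` set l)"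
proof (induction l)
  case (Cons i l)
  let ?N = "M \<union> Main ` set (i # l) \<union> Twin ` set (i # l)"
  have "diff_op l y \<in> nagata ?N"
    using Cons nagata_mono[of _ ?N] by (rule rev_subsetD) auto
  moreover from this have "swap (twin i) (diff_op l y) \<in> nagata (twin i ` ?N)"
    by (intro swap_nagata) simp_all
  moreover have "nagata (twin i ` ?N) \<subseteq> nagata ?N" by (rule nagata_mono) (auto simp: twin_def)
  ultimately have "diff_op l y - swap (twin i) (diff_op l y) \<in> nagata ?N"
    by (intro zmod.subspace_diff[OF subspace_nagata]) (assumption, blast)
  thus ?case by simp
qed (use assms in simp)

text \<open>By distinctness, the factors acting before that of \<open>i\<close> introduce neither
  \<open>Main i\<close> nor \<open>Twin i\<close>. So the transposition fixes the intermediate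
  result, and the factor of \<open>i\<close> sends it to zero.\<close>

lemma diff_op_eq_0:
  assumes "y \<in> nagata M" "distinct l" "i \<in> set l" "Main i \<notin> M" "Twin i \<notin> M"
  shows "diff_op l y = 0"
  using assms(2,3)
proof (induction l)
  case (Cons j l)
  show ?case
  proof (cases "j = i")
    case True
    hence "swap (twin i) (diff_op l y) = diff_op l y"
      using Cons.prems assms by (intro swap_fixed[OF _ diff_op_nagata[OF assms(1)]]) (auto simp: twin_def)
    thus ?thesis using True by simp
  next
    case False
    hence "diff_op l y = 0" using Cons by auto
    moreover have "swap (twin j) (0 :: 'a ratfun) = 0"
      using swap_fixed[of "twin j" 0 "{}"] nagata_of_int[of 0 "{}"] by simp
    ultimately show ?thesis by simp
  qed
qed simp

text \<open>Each factor subtracts a term in which \<open>Main j\<close> has been replaced by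
  \<open>Twin j\<close>, and which is therefore free of \<open>Main j\<close>.\<close>

lemma diff_op_minus_id:
  assumes "y \<in> nagata M" "distinct l" "Main ` set l \<subseteq> M" "Twin ` set l \<inter> M = {}"
  shows "diff_op l y - y \<in> zmod.span (\<Union>i\<in>set l. nagata (M \<union> Twin ` set l - {Main i}))"
  using assms(2-4)
proof (induction l)
  case Nil
  show ?case by (simp add: zmod.span_zero)
next
  case (Cons j l)
  let ?N = "\<lambda>l i. M \<union> Twin ` set l - {Main i}"
  let ?S = "\<lambda>l. zmod.span (\<Union>i\<in>set l. nagata (?N l i))"
  have "diff_op l y - y \<in> ?S l" using Cons by auto
  moreover have "?S l \<subseteq> ?S (j # l)"
  proof (rule zmod.span_mono)
    have "nagata (?N l i) \<subseteq> nagata (?N (j # l) i)" for i by (rule nagata_mono) auto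
    thus "(\<Union>i\<in>set l. nagata (?N l i)) \<subseteq> (\<Union>i\<in>set (j # l). nagata (?N (j # l) i))" by fastforce
  qed
  ultimately have 1: "diff_op l y - y \<in> ?S (j # l)" by blast
  have "M \<union> Main ` set l \<union> Twin ` set l = M \<union> Twin ` set l" using Cons.prems by auto
  hence "diff_op l y \<in> nagata (M \<union> Twin ` set l)" using diff_op_nagata[OF assms(1), of l] by simp
  hence "swap (twin j) (diff_op l y) \<in> nagata (twin j ` (M \<union> Twin ` set l))"
    by (intro swap_nagata) simp_all
  \<comment> \<open>Since \<open>Twin j\<close> is neither in \<open>M\<close> nor among the twins
    of \<open>l\<close>, the transposition does not bring \<open>Main j\<close> back.\<close>
  moreover have "twin j ` (M \<union> Twin ` set l) \<subseteq> ?N (j # l) j"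
    using Cons.prems by (auto simp: twin_def)
  ultimately have "swap (twin j) (diff_op l y) \<in> nagata (?N (j # l) j)"
    using nagata_mono by blast
  hence 2: "swap (twin j) (diff_op l y) \<in> ?S (j # l)" by (intro zmod.span_base) auto
  have eq: "diff_op (j # l) y - y = (diff_op l y - y) - swap (twin j) (diff_op l y)" by simp
  show ?case unfolding eq by (rule zmod.span_diff[OF 1 2])
qed

text \<open>If the operator kills \<open>y\<close>, then \<open>diff_op_minus_id\<close> writes
  \<open>y\<close> as a sum of terms each free of some \<open>Main i\<close>, but possibly involving
  twins. Renaming the twins to spare indeterminates absent from \<open>y\<close> puts the terms back
  into the smaller rings without changing \<open>y\<close>.\<close>

lemma diff_op_kernel:
  assumes y: "y \<in> nagata (Main ` set l \<union> range Spare)" "distinct l" "diff_op l y = 0"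
  shows "y \<in> zmod.span (\<Union>i\<in>set l. nagata (Main ` (set l - {i}) \<union> range Spare))"
proof -
  obtain K where K: "finite K" "K \<subseteq> Main ` set l \<union> range Spare" "y \<in> nagata K"
    using y(1) by (rule nagata_finite_support)
  define C where "C = {n. Spare n \<in> K}"
  have "finite C"
    unfolding C_def using finite_vimageI[OF K(1), of Spare] by (simp add: vimage_def inj_def)
  define M where "M = Main ` set l \<union> Spare ` C"
  have "K \<subseteq> M" using K(2) by (auto simp: M_def C_def)
  hence yM: "y \<in> nagata M" using K nagata_mono by blast
  have "infinite (- C)" using \<open>finite C\<close> by (simp add: finite_compl)
  then obtain S where "finite S" "card S = card (set l)" "S \<subseteq> - C"
    using infinite_arbitrarily_large by blast
  then obtain f where f: "bij_betw f (set l) S" using finite_same_card_bij by (metis List.finite_set)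
  have finj: "inj_on f (set l)" using f by (simp add: bij_betw_def)
  have fC: "f i \<notin> C" if "i \<in> set l" for i using f \<open>S \<subseteq> - C\<close> that by (auto simp: bij_betw_def)
  \<comment> \<open>\<open>\<tau>\<close> exchanges each \<open>Twin i\<close> with its fresh
    \<open>Spare (f i)\<close>; being an involution, it can be used with
    \<open>swap\<close>.\<close>
  define \<tau> where "\<tau> v = (case v of Main i \<Rightarrow> Main i
      | Twin i \<Rightarrow> if i \<in> set l then Spare (f i) else Twin i
      | Spare n \<Rightarrow> if n \<in> f ` set l then Twin (inv_into (set l) f n) else Spare n)" for v
  have invol: "\<tau> (\<tau> v) = v" for v
  proof (cases v)
    case (Spare n)
    show ?thesis
    proof (cases "n \<in> f ` set l")
      case True
      then obtain i where "i \<in> set l" "n = f i" by blast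
      moreover from this have "inv_into (set l) f n = i" by (simp add: finj)
      ultimately show ?thesis by (simp add: \<tau>_def Spare)
    qed (simp add: \<tau>_def Spare)
  qed (simp_all add: \<tau>_def finj)
  have fixed: "\<tau> v = v" if "v \<in> M" for v
    using that fC by (auto simp: M_def \<tau>_def)
  interpret \<tau>: module_hom "\<lambda>(n::int) x. of_int n * x" "\<lambda>(n::int) x. of_int n * x" "swap \<tau>"
    by (rule module_hom_additive) (rule swap_add[OF invol])
  let ?N = "\<lambda>i. M \<union> Twin ` set l - {Main i}"
  have "diff_op l y - y \<in> zmod.span (\<Union>i\<in>set l. nagata (?N i))"
    using yM y(2) by (rule diff_op_minus_id) (auto simp: M_def)
  from zmod.span_neg[OF this] have "y \<in> zmod.span (\<Union>i\<in>set l. nagata (?N i))"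
    unfolding y(3) by (simp only: diff_0 minus_minus)
  hence "swap \<tau> y \<in> zmod.span (swap \<tau> ` (\<Union>i\<in>set l. nagata (?N i)))"
    unfolding \<tau>.span_image by (rule imageI)
  moreover have "swap \<tau> y = y" using swap_fixed[OF invol yM fixed] .
  ultimately have mem: "y \<in> zmod.span (swap \<tau> ` (\<Union>i\<in>set l. nagata (?N i)))" by (simp only:)
  have "swap \<tau> ` (\<Union>i\<in>set l. nagata (?N i))
      \<subseteq> (\<Union>i\<in>set l. nagata (Main ` (set l - {i}) \<union> range Spare))"
  proof -
    have "swap \<tau> z \<in> nagata (Main ` (set l - {i}) \<union> range Spare)"
      if "i \<in> set l" "z \<in> nagata (?N i)" for i z
    proof -
      have "\<tau> ` ?N i \<subseteq> Main ` (set l - {i}) \<union> range Spare"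
        using fC by (auto simp: \<tau>_def M_def)
      thus ?thesis using swap_nagata[OF invol that(2)] nagata_mono by blast
    qed
    thus ?thesis by blast
  qed
  from zmod.span_mono[OF this] mem show ?thesis by (rule subsetD)
qed

section \<open>A basis of the localization\<close>

lemma eqpoll_square_infinite: "infinite A \<Longrightarrow> A \<times> A \<approx> A"
  unfolding eqpoll_iff_card_of_ordIso by (rule card_of_Times_same_infinite)

text \<open>With exponents read as integers, monomials embed into the free abelian group on
  \<open>J\<close>, and integer polynomials are the free abelian group on monomials. For an infinite
  set neither passage raises the cardinality, nor does taking pairs for fractions.\<close>

lemma nagata_lepoll:
  fixes J :: "'v::linorder set"
  assumes "infinite J"
  shows "nagata J \<lesssim> J"
proof -
  define Mon where "Mon = {m :: 'v \<Rightarrow>\<^sub>0 nat. Poly_Mapping.keys m \<subseteq> J}"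
  have lookup_int: "Poly_Mapping.lookup (Poly_Mapping.map int m) v = int (Poly_Mapping.lookup m v)"
    for m :: "'v \<Rightarrow>\<^sub>0 nat" and v
    by (simp add: Poly_Mapping.map.rep_eq when_def)
  have inj: "inj (Poly_Mapping.map int :: ('v \<Rightarrow>\<^sub>0 nat) \<Rightarrow> 'v \<Rightarrow>\<^sub>0 int)"
    by (rule injI, rule poly_mapping_eqI) (metis lookup_int of_nat_eq_iff)
  have "Poly_Mapping.map int ` Mon \<subseteq> carrier (free_Abelian_group J)"
  proof -
    have "Poly_Mapping.keys (Poly_Mapping.map int m) = Poly_Mapping.keys m" for m :: "'v \<Rightarrow>\<^sub>0 nat"
      by (auto simp: in_keys_iff lookup_int)
    thus ?thesis by (auto simp: Mon_def)
  qed
  hence "Mon \<lesssim> carrier (free_Abelian_group J)"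
    unfolding lepoll_def using inj_on_subset[OF inj subset_UNIV] by blast
  also have "\<dots> \<approx> J" using assms by (rule eqpoll_free_Abelian_group_infinite)
  finally have Mon: "Mon \<lesssim> J" .
  have "inj (\<lambda>v::'v. Poly_Mapping.single v (1::nat))"
    by (rule injI) (metis keys_single singleton_inject zero_neq_one)
  hence "J \<lesssim> Mon"
    unfolding lepoll_def by (intro exI[of _ "\<lambda>v. Poly_Mapping.single v 1"]) (auto simp: Mon_def inj_on_def)
  hence "infinite Mon" using assms by (meson finite_lepoll_infinite lepoll_def finite_subset finite_imageD inj_on_finite)
  have "polys_on J = carrier (free_Abelian_group Mon)"
    by (simp add: free_Abelian_group_def polys_on_def Mon_def subset_eq)
  also have "\<dots> \<approx> Mon" using \<open>infinite Mon\<close> by (rule eqpoll_free_Abelian_group_infinite)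
  also note Mon
  finally have P: "polys_on J \<lesssim> J" .
  have "nagata J \<subseteq> (\<lambda>(f, g). to_fract f / to_fract g) ` (polys_on J \<times> polys_on J)"
  proof
    fix y assume "y \<in> nagata J"
    then obtain f g where "f \<in> polys_on J" "g \<in> polys_on J" "y = to_fract f / to_fract g"
      by (rule nagataE)
    thus "y \<in> (\<lambda>(f, g). to_fract f / to_fract g) ` (polys_on J \<times> polys_on J)"
      by (intro image_eqI[of _ _ "(f, g)"]) simp_all
  qed
  hence "nagata J \<lesssim> polys_on J \<times> polys_on J" by (rule subset_image_lepoll)
  also have "\<dots> \<lesssim> J \<times> J" using P P by (rule times_lepoll_mono)
  also have "\<dots> \<approx> J" using assms by (rule eqpoll_square_infinite)
  finally show ?thesis .
qed

lemma countable_nagata: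
  assumes "countable J" "infinite J" shows "countable (nagata J)"
  using countable_lepoll[OF assms(1) nagata_lepoll[OF assms(2)]] .

abbreviation ring_on :: "'a set \<Rightarrow> 'a ratfun set"
  where "ring_on A \<equiv> nagata (Main ` A \<union> range Spare)"

definition enum :: "'a set \<Rightarrow> 'a list"
  where "enum F = (SOME l. set l = F \<and> distinct l)"

lemma enum: "finite F \<Longrightarrow> set (enum F) = F \<and> distinct (enum F)"
  unfolding enum_def by (rule someI_ex) (rule finite_distinct_list)

lemma diff_op_ring_on_eq_0:
  assumes "finite F" "\<not> F \<subseteq> E" "y \<in> ring_on E" shows "diff_op (enum F) y = 0"
proof -
  obtain i where "i \<in> F" "i \<notin> E" using assms by blast
  thus ?thesis using assms(3) by (intro diff_op_eq_0[of y _ _ i]) (auto simp: enum[OF assms(1)])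
qed

text \<open>The image of \<open>ring_on F\<close> under the operator is only a subgroup of a
  localization in countably many indeterminates, including the twins. Pontryagin's criterion is
  applied to it with that localization as the ambient \<open>H\<close>, and the basis is then
  lifted.\<close>

lemma diff_op_basis:
  fixes F :: "'a set"
  assumes "finite F"
  obtains B where "B \<subseteq> ring_on F" "inj_on (diff_op (enum F)) B"
    "zmod.independent (diff_op (enum F) ` B)"
    "\<And>y. y \<in> ring_on F \<Longrightarrow> diff_op (enum F) y \<in> zmod.span (diff_op (enum F) ` B)"
proof -
  let ?D = "diff_op (enum F)" and ?J = "Main ` F \<union> Twin ` F \<union> range Spare"
  have "infinite (range Spare :: 'a indet set)" by (rule range_inj_infinite) (simp add: inj_def)
  hence cnt: "countable (nagata ?J)"
    using assms by (intro countable_nagata) (auto intro: countable_finite)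
  have sub: "?D ` ring_on F \<subseteq> nagata ?J"
  proof
    fix z assume "z \<in> ?D ` ring_on F"
    then obtain y where "y \<in> ring_on F" "z = ?D y" by blast
    with diff_op_nagata[of y "Main ` F \<union> range Spare" "enum F"]
    show "z \<in> nagata ?J" by (simp add: enum[OF assms] Un_ac)
  qed
  have sp: "zmod.subspace (?D ` ring_on F)"
    by (rule diff_op.subspace_image) (rule subspace_nagata)
  obtain U where U: "U \<subseteq> ?D ` ring_on F" "zmod.independent U" "?D ` ring_on F \<subseteq> zmod.span U"
    by (rule countable_group_has_basis[OF cnt sub sp nagata_finite_rank])
  obtain B where B: "B \<subseteq> ring_on F" "inj_on ?D B" "U = ?D ` B"
    using U(1) by (meson subset_image_inj)
  show ?thesis by (rule that[OF B(1,2)]) (use U B in auto)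
qed

text \<open>
  If \<open>F\<close> is a maximal index occurring in a linear relation between elements of the bases \<open>B E\<close>, the
  difference operator for \<open>F\<close> kills all terms except those with index \<open>F\<close>. Conversely, subtracting
  elements of \<open>B F\<close> moves any element of \<open>ring_on F\<close> into the kernel of this operator, which
  is spanned by the rings for smaller index sets.
\<close>
lemma ring_on_has_basis:
  fixes A :: "'a set"
  obtains B where "B \<subseteq> ring_on A" "zmod.independent B" "ring_on A \<subseteq> zmod.span B"
proof -
  define P where "P F B \<longleftrightarrow> B \<subseteq> ring_on F \<and> inj_on (diff_op (enum F)) B \<and>
    zmod.independent (diff_op (enum F) ` B) \<and>
    (\<forall>y\<in>ring_on F. diff_op (enum F) y \<in> zmod.span (diff_op (enum F) ` B))" for F :: "'a set" and B
  define B where "B F = (SOME B. P F B)" for F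
  have P: "P F (B F)" if "finite F" for F
  proof -
    have "\<exists>B. P F B" unfolding P_def by (rule diff_op_basis[OF that]) blast
    thus ?thesis unfolding B_def by (rule someI_ex)
  qed
  have B: "B F \<subseteq> ring_on F" if "finite F" for F using P[OF that] unfolding P_def by blast
  have inj: "inj_on (diff_op (enum F)) (B F)" if "finite F" for F
    using P[OF that] unfolding P_def by blast
  have indep: "zmod.independent (diff_op (enum F) ` B F)" if "finite F" for F
    using P[OF that] unfolding P_def by blast
  have span: "diff_op (enum F) y \<in> zmod.span (diff_op (enum F) ` B F)"
    if "finite F" "y \<in> ring_on F" for F y
    using P[OF that(1)] that(2) unfolding P_def by blast
  have mono: "ring_on F \<subseteq> ring_on A" if "F \<subseteq> A" for F
    using that by (intro nagata_mono) auto
  define U where "U = (\<Union>F\<in>{F. finite F \<and> F \<subseteq> A}. B F)"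
  have UA: "U \<subseteq> ring_on A"
    unfolding U_def by (intro UN_least) (use subset_trans[OF B mono] in simp)
  have indepU: "zmod.independent U"
  proof
    assume "zmod.dependent U"
    then obtain T c where T: "finite T" "T \<subseteq> U" "(\<Sum>v\<in>T. of_int (c v) * v) = 0" "\<exists>v\<in>T. c v \<noteq> 0"
      unfolding zmod.dependent_explicit by blast
    have "\<forall>v\<in>T. \<exists>F. finite F \<and> v \<in> B F" using T(2) by (auto simp: U_def)
    then obtain ix where ix: "\<And>v. v \<in> T \<Longrightarrow> finite (ix v) \<and> v \<in> B (ix v)" by metis
    define S where "S = {v\<in>T. c v \<noteq> 0}"
    have "finite S" "S \<noteq> {}" using T by (auto simp: S_def)
    hence "Max ((\<lambda>v. card (ix v)) ` S) \<in> (\<lambda>v. card (ix v)) ` S" by (intro Max_in) auto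
    then obtain w where w: "w \<in> S" "Max ((\<lambda>v. card (ix v)) ` S) = card (ix w)" by blast
    \<comment> \<open>Maximal cardinality suffices: a finite index containing \<open>F\<close> and
      no larger than \<open>F\<close> equals \<open>F\<close>.\<close>
    have max: "card (ix v) \<le> card (ix w)" if "v \<in> S" for v
      unfolding w(2)[symmetric] using that \<open>finite S\<close> by (intro Max_ge) auto
    define F where "F = ix w"
    have F: "finite F" using w ix by (auto simp: S_def F_def)
    let ?D = "diff_op (enum F)"
    have kill: "?D v = 0" if "v \<in> S" "ix v \<noteq> F" for v
    proof (rule diff_op_ring_on_eq_0[OF F])
      have "finite (ix v)" "v \<in> B (ix v)" using that ix by (auto simp: S_def)
      show "\<not> F \<subseteq> ix v"
        using that max[OF that(1)] \<open>finite (ix v)\<close> card_seteq[of "ix v" F] by (auto simp: F_def)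
      show "v \<in> ring_on (ix v)" using B \<open>finite (ix v)\<close> \<open>v \<in> B (ix v)\<close> by blast
    qed
    define W where "W = {v\<in>S. ix v = F}"
    have WB: "W \<subseteq> B F" using ix by (auto simp: W_def S_def)
    have "0 = ?D (\<Sum>v\<in>T. of_int (c v) * v)" by (simp add: T(3))
    also have "\<dots> = (\<Sum>v\<in>T. of_int (c v) * ?D v)" by (simp add: diff_op.sum diff_op.scale)
    also have "\<dots> = (\<Sum>v\<in>W. of_int (c v) * ?D v)"
      using kill T(1) by (intro sum.mono_neutral_right) (auto simp: W_def S_def)
    \<comment> \<open>Independence is known for the images under \<open>?D\<close>, so the relation
      is reindexed along \<open>?D\<close>, which is injective on \<open>B F\<close>.\<close>
    also have "\<dots> = (\<Sum>z\<in>?D ` W. of_int (c (inv_into W ?D z)) * z)"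
      using inj_on_subset[OF inj[OF F] WB] by (subst sum.reindex) (auto intro!: sum.cong)
    finally have sum0: "(\<Sum>z\<in>?D ` W. of_int (c (inv_into W ?D z)) * z) = 0" by simp
    have "w \<in> W" using w by (simp add: W_def F_def)
    have "c (inv_into W ?D (?D w)) = 0"
    proof (rule zmod.independentD[OF indep[OF F] _ _ sum0])
      show "finite (?D ` W)" using \<open>finite S\<close> by (simp add: W_def)
    qed (use WB \<open>w \<in> W\<close> in auto)
    hence "c w = 0" using \<open>w \<in> W\<close> inj_on_subset[OF inj[OF F] WB] by simp
    thus False using w by (simp add: S_def)
  qed
  have fin: "ring_on F \<subseteq> zmod.span U" if "finite F" "F \<subseteq> A" for F
    using that
  proof (induction F rule: finite_psubset_induct)
    case (psubset F)
    let ?D = "diff_op (enum F)"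
    have BU: "zmod.span (B F) \<subseteq> zmod.span U"
      using psubset by (intro zmod.span_mono) (auto simp: U_def)
    show ?case
    proof
      fix y assume y: "y \<in> ring_on F"
      have "?D y \<in> ?D ` zmod.span (B F)"
        using span[OF psubset(1) y] by (simp only: diff_op.span_image)
      then obtain z where z: "z \<in> zmod.span (B F)" "?D y = ?D z" by blast
      have "zmod.span (B F) \<subseteq> ring_on F"
        using B[OF psubset(1)] subspace_nagata by (rule zmod.span_minimal)
      hence "y - z \<in> ring_on F" using y z zmod.subspace_diff[OF subspace_nagata] by blast
      moreover have "?D (y - z) = 0" using z by (simp only: diff_op.diff diff_self)
      ultimately have "y - z \<in> zmod.span (\<Union>i\<in>F. ring_on (F - {i}))"
        using diff_op_kernel[of "y - z" "enum F"] enum[OF psubset(1)] by simp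
      moreover have "(\<Union>i\<in>F. ring_on (F - {i})) \<subseteq> zmod.span U"
      proof (rule UN_least)
        fix i assume "i \<in> F"
        hence "F - {i} \<subset> F" by blast
        thus "ring_on (F - {i}) \<subseteq> zmod.span U" using psubset.IH psubset.prems by blast
      qed
      ultimately have "y - z \<in> zmod.span U"
        using zmod.span_minimal[OF _ zmod.subspace_span] by blast
      moreover have "z \<in> zmod.span U" using z BU by blast
      ultimately have "(y - z) + z \<in> zmod.span U" by (rule zmod.span_add)
      thus "y \<in> zmod.span U" by simp
    qed
  qed
  have "ring_on A \<subseteq> zmod.span U"
  proof
    fix y assume "y \<in> ring_on A"
    then obtain K where K: "finite K" "K \<subseteq> Main ` A \<union> range Spare" "y \<in> nagata K"
      by (rule nagata_finite_support)
    define F where "F = {i\<in>A. Main i \<in> K}"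
    have "finite F"
      using finite_vimageI[OF K(1), of Main] by (rule rev_finite_subset) (auto simp: F_def inj_def)
    moreover have "K \<subseteq> Main ` F \<union> range Spare" using K(2) by (auto simp: F_def)
    hence "y \<in> ring_on F" using K nagata_mono by blast
    ultimately show "y \<in> zmod.span U" using fin[of F] by (auto simp: F_def)
  qed
  thus ?thesis by (rule that[OF UA indepU])
qed

section \<open>Transport to a given carrier\<close>

text \<open>The final ring has to live on a prescribed type, so a set \<open>S\<close> closed under
  the ring operations is carried over along a map \<open>h\<close> injective on
  \<open>S\<close>.\<close>

definition copy_ring :: "('k \<Rightarrow> 'a) \<Rightarrow> 'k::comm_ring_1 set \<Rightarrow> 'a ring"
  where "copy_ring h S = \<lparr>carrier = h ` S,
    monoid.mult = \<lambda>x y. h (inv_into S h x * inv_into S h y), monoid.one = h 1,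
    ring.zero = h 0, ring.add = \<lambda>x y. h (inv_into S h x + inv_into S h y)\<rparr>"

locale subring_copy =
  fixes S :: "'k::idom set" and h :: "'k \<Rightarrow> 'a"
  assumes inj: "inj_on h S" and subspace: "zmod.subspace S"
    and one: "1 \<in> S" and mult: "\<And>x y. x \<in> S \<Longrightarrow> y \<in> S \<Longrightarrow> x * y \<in> S"
begin

abbreviation "R \<equiv> copy_ring h S"

lemmas zero = zmod.subspace_0[OF subspace]
lemmas add = zmod.subspace_add[OF subspace]

lemma h_eq_iff: "x \<in> S \<Longrightarrow> y \<in> S \<Longrightarrow> h x = h y \<longleftrightarrow> x = y"
  using inj by (auto simp: inj_on_def)

lemma carrier_copy: "carrier R = h ` S"
  by (simp add: copy_ring_def)

lemma copy_simps:
  "x \<in> S \<Longrightarrow> y \<in> S \<Longrightarrow> h x \<otimes>\<^bsub>R\<^esub> h y = h (x * y)"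
  "x \<in> S \<Longrightarrow> y \<in> S \<Longrightarrow> h x \<oplus>\<^bsub>R\<^esub> h y = h (x + y)"
  "\<one>\<^bsub>R\<^esub> = h 1" "\<zero>\<^bsub>R\<^esub> = h 0"
  using inj by (simp_all add: copy_ring_def)

lemma of_int: "of_int k \<in> S"
  using zmod.subspace_scale[OF subspace one, of k] by simp

lemma domain_copy: "domain R"
proof (rule domainI)
  show "cring R"
  proof (rule cringI)
    show "abelian_group R"
    proof (rule abelian_groupI)
      fix x assume "x \<in> carrier R"
      then obtain y where "y \<in> S" "x = h y" by (auto simp: carrier_copy)
      thus "\<exists>y\<in>carrier R. y \<oplus>\<^bsub>R\<^esub> x = \<zero>\<^bsub>R\<^esub>"
        using zmod.subspace_neg[OF subspace]
        by (intro bexI[of _ "h (- y)"]) (auto simp: carrier_copy copy_simps)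
    qed (auto simp: carrier_copy copy_simps zero add ac_simps)
    show "comm_monoid R"
      by (rule comm_monoidI) (auto simp: carrier_copy copy_simps one mult ac_simps)
  qed (auto simp: carrier_copy copy_simps add mult algebra_simps)
qed (auto simp: carrier_copy copy_simps h_eq_iff zero one mult)

text \<open>An ideal is generated by the generator \<open>d\<close> of its integers: if it contains
  \<open>y = n * u\<close> with \<open>u\<close> a unit, it contains \<open>n\<close>, so
  \<open>d\<close> divides \<open>n\<close>.\<close>

lemma noetherian_copy:
  assumes unit: "\<And>y. y \<in> S \<Longrightarrow> y \<noteq> 0 \<Longrightarrow> \<exists>n u v. y = of_int n * u \<and> u \<in> S \<and> v \<in> S \<and> u * v = 1"
  shows "noetherian_domain R"
proof -
  interpret domain R by (rule domain_copy)
  have "\<exists>A\<subseteq>carrier R. finite A \<and> I = Idl\<^bsub>R\<^esub> A" if "ideal I R" for I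
  proof -
    interpret ideal I R by (rule that)
    define N where "N = {k::int. h (of_int k) \<in> I}"
    have scale: "h (s * x) \<in> I" if "h x \<in> I" "x \<in> S" "s \<in> S" for s x
      using I_l_closed[OF that(1), of "h s"] that by (simp add: carrier_copy copy_simps)
    have "0 \<in> N" using additive_subgroup.zero_closed[OF additive_subgroup_axioms]
      by (simp add: N_def copy_simps)
    moreover have "k - m \<in> N" if "k \<in> N" "m \<in> N" for k m
    proof -
      have "h (of_int k) \<oplus>\<^bsub>R\<^esub> h (of_int (- 1) * of_int m) \<in> I"
        using that scale of_int unfolding N_def
        by (intro additive_subgroup.a_closed[OF additive_subgroup_axioms]) blast+
      moreover have "h (of_int k) \<oplus>\<^bsub>R\<^esub> h (of_int (- 1) * of_int m) = h (of_int (k - m))"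
        using copy_simps(2)[OF of_int[of k] mult[OF of_int[of "-1"] of_int[of m]]] by simp
      ultimately show ?thesis by (simp add: N_def)
    qed
    ultimately obtain d where d: "d \<in> N" "\<And>k. k \<in> N \<Longrightarrow> d dvd k"
      using int_subgroup_principal by metis
    have hd: "{h (of_int d)} \<subseteq> carrier R" by (simp add: carrier_copy of_int)
    have "I = Idl\<^bsub>R\<^esub> {h (of_int d)}"
    proof
      show "Idl\<^bsub>R\<^esub> {h (of_int d)} \<subseteq> I"
        using d(1) by (intro genideal_minimal[OF that]) (simp add: N_def)
    next
      interpret J: ideal "Idl\<^bsub>R\<^esub> {h (of_int d)}" R by (rule genideal_ideal[OF hd])
      show "I \<subseteq> Idl\<^bsub>R\<^esub> {h (of_int d)}"
      proof
        fix x assume x: "x \<in> I"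
        then obtain y where y: "y \<in> S" "x = h y" using a_subset by (auto simp: carrier_copy)
        show "x \<in> Idl\<^bsub>R\<^esub> {h (of_int d)}"
        proof (cases "y = 0")
          case True
          thus ?thesis using additive_subgroup.zero_closed[OF J.additive_subgroup_axioms] y
            by (simp add: copy_simps)
        next
          case False
          then obtain n u v where nuv: "y = of_int n * u" "u \<in> S" "v \<in> S" "u * v = 1"
            using unit y by blast
          have "v * y = of_int n * (u * v)" by (simp add: nuv(1) ac_simps)
          hence "v * y = of_int n" by (simp only: nuv(4) mult_1_right)
          moreover have "h (v * y) \<in> I" using scale[of y v] x y nuv(3) by blast
          ultimately have "n \<in> N" by (simp add: N_def)
          then obtain k where "n = d * k" using d by (auto simp: dvd_def)
          hence eq: "h (of_int k * u) \<otimes>\<^bsub>R\<^esub> h (of_int d) = x"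
            using y nuv by (simp add: copy_simps mult of_int ac_simps)
          have "h (of_int k * u) \<in> carrier R" using nuv mult of_int by (simp add: carrier_copy)
          moreover have "h (of_int d) \<in> Idl\<^bsub>R\<^esub> {h (of_int d)}" using genideal_self[OF hd] by simp
          ultimately show ?thesis using J.I_l_closed eq by blast
        qed
      qed
    qed
    thus ?thesis using hd by blast
  qed
  hence "noetherian_ring R" by (rule noetherian_ringI)
  thus ?thesis using domain_copy by (simp add: noetherian_domain_def)
qed

lemma free_abelian_copy:
  assumes U: "U \<subseteq> S" "zmod.independent U" "S \<subseteq> zmod.span U"
  shows "is_free_abelian (add_monoid R)"
proof -
  interpret domain R by (rule domain_copy)
  let ?g = "inv_into S h"
  \<comment> \<open>The indices are the images of \<open>U\<close> under \<open>h\<close>, since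
    \<open>is_free_abelian\<close> takes its index set from the element type; \<open>\<phi>\<close>
    evaluates formal combinations in \<open>S\<close>.\<close>
  define \<phi> where "\<phi> c = (\<Sum>b\<in>Poly_Mapping.keys c. of_int (Poly_Mapping.lookup c b) * ?g b)" for c :: "'a \<Rightarrow>\<^sub>0 int"
  have \<phi>_superset: "\<phi> c = (\<Sum>b\<in>T. of_int (Poly_Mapping.lookup c b) * ?g b)"
    if "finite T" "Poly_Mapping.keys c \<subseteq> T" for c T
    unfolding \<phi>_def using that by (intro sum.mono_neutral_left) (auto simp: in_keys_iff)
  have \<phi>_add: "\<phi> (c + d) = \<phi> c + \<phi> d" for c d
  proof -
    let ?T = "Poly_Mapping.keys c \<union> Poly_Mapping.keys d"
    have "\<phi> (c + d) = (\<Sum>b\<in>?T. of_int (Poly_Mapping.lookup (c + d) b) * ?g b)"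
      using keys_add[of c d] by (intro \<phi>_superset) auto
    also have "\<dots> = (\<Sum>b\<in>?T. of_int (Poly_Mapping.lookup c b) * ?g b)
        + (\<Sum>b\<in>?T. of_int (Poly_Mapping.lookup d b) * ?g b)"
      by (simp add: lookup_add distrib_right sum.distrib)
    also have "\<dots> = \<phi> c + \<phi> d" by (simp add: \<phi>_superset[symmetric])
    finally show ?thesis .
  qed
  have gU: "?g b \<in> U" if "b \<in> h ` U" for b
    using that U(1) inj by (metis imageE inv_into_f_f subsetD)
  have \<phi>_S: "\<phi> c \<in> S" if "Poly_Mapping.keys c \<subseteq> h ` U" for c
    unfolding \<phi>_def
    by (intro zmod.subspace_sum[OF subspace] zmod.subspace_scale[OF subspace]) (use gU that U(1) in blast)
  have \<phi>_eq_0: "c = 0" if c: "Poly_Mapping.keys c \<subseteq> h ` U" "\<phi> c = 0" for c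
  proof -
    let ?T = "?g ` Poly_Mapping.keys c"
    have inv: "h (?g b) = b" if "b \<in> h ` U" for b using that U(1) by (intro f_inv_into_f) auto
    have ginj: "inj_on ?g (Poly_Mapping.keys c)"
      by (rule inj_on_inverseI[of _ h]) (use inv c in blast)
    have "(\<Sum>v\<in>?T. of_int (Poly_Mapping.lookup c (h v)) * v) = \<phi> c"
      unfolding \<phi>_def by (subst sum.reindex[OF ginj]) (auto intro!: sum.cong simp: inv[OF subsetD[OF c(1)]])
    hence sum0: "(\<Sum>v\<in>?T. of_int (Poly_Mapping.lookup c (h v)) * v) = 0" using c(2) by simp
    have "Poly_Mapping.lookup c (h v) = 0" if "v \<in> ?T" for v
      by (rule zmod.independentD[OF U(2) _ _ sum0 that]) (use gU c in auto)
    hence "Poly_Mapping.lookup c b = 0" if "b \<in> Poly_Mapping.keys c" for b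
      using that inv[OF subsetD[OF c(1) that]] by (metis imageI)
    thus ?thesis by (metis in_keys_iff poly_mapping_eqI lookup_zero)
  qed
  have \<phi>_surj: "\<exists>c. Poly_Mapping.keys c \<subseteq> h ` U \<and> \<phi> c = y" if "y \<in> zmod.span U" for y
    using that
  proof (induction rule: zmod.span_induct_alt)
    case base
    show ?case by (intro exI[of _ 0]) (simp add: \<phi>_def)
  next
    case (step k x y)
    then obtain c where c: "Poly_Mapping.keys c \<subseteq> h ` U" "\<phi> c = y" by blast
    have "?g (h x) = x" using step U(1) inj by (auto intro: inv_into_f_f)
    hence "\<phi> (Poly_Mapping.single (h x) k) = of_int k * x" by (simp add: \<phi>_def)
    moreover have "Poly_Mapping.keys (Poly_Mapping.single (h x) k + c) \<subseteq> h ` U"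
      using keys_add[of "Poly_Mapping.single (h x) k" c] c(1) step(1) by (auto split: if_splits)
    ultimately show ?case using c(2) \<phi>_add by metis
  qed
  have "(\<lambda>c. h (\<phi> c)) \<in> iso (free_Abelian_group (h ` U)) (add_monoid R)"
  proof (rule isoI)
    show "(\<lambda>c. h (\<phi> c)) \<in> hom (free_Abelian_group (h ` U)) (add_monoid R)"
      by (rule homI) (simp_all add: carrier_copy \<phi>_S \<phi>_add copy_simps)
    show "bij_betw (\<lambda>c. h (\<phi> c)) (carrier (free_Abelian_group (h ` U))) (carrier (add_monoid R))"
    proof (rule bij_betw_imageI)
      show "inj_on (\<lambda>c. h (\<phi> c)) (carrier (free_Abelian_group (h ` U)))"
      proof (rule inj_onI)
        fix c d assume cd: "c \<in> carrier (free_Abelian_group (h ` U))"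
          "d \<in> carrier (free_Abelian_group (h ` U))" "h (\<phi> c) = h (\<phi> d)"
        hence "\<phi> c = \<phi> d" using h_eq_iff \<phi>_S by simp
        moreover have "\<phi> c = \<phi> (c - d) + \<phi> d" using \<phi>_add[of "c - d" d] by simp
        ultimately have "\<phi> (c - d) = 0" by simp
        moreover have "Poly_Mapping.keys (c - d) \<subseteq> h ` U" using cd keys_diff[of c d] by auto
        ultimately have "c - d = 0" using \<phi>_eq_0 by blast
        thus "c = d" by simp
      qed
      show "(\<lambda>c. h (\<phi> c)) ` carrier (free_Abelian_group (h ` U)) = carrier (add_monoid R)"
      proof
        show "(\<lambda>c. h (\<phi> c)) ` carrier (free_Abelian_group (h ` U)) \<subseteq> carrier (add_monoid R)"
          using \<phi>_S by (auto simp: carrier_copy)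
        show "carrier (add_monoid R) \<subseteq> (\<lambda>c. h (\<phi> c)) ` carrier (free_Abelian_group (h ` U))"
        proof
          fix x assume "x \<in> carrier (add_monoid R)"
          then obtain y where y: "y \<in> S" "x = h y" by (auto simp: carrier_copy)
          then obtain c where "Poly_Mapping.keys c \<subseteq> h ` U" "\<phi> c = y" using \<phi>_surj U(3) by blast
          thus "x \<in> (\<lambda>c. h (\<phi> c)) ` carrier (free_Abelian_group (h ` U))"
            using y by (intro image_eqI[of _ _ c]) simp_all
        qed
      qed
    qed
  qed
  hence "free_Abelian_group (h ` U) \<cong> add_monoid R" by (rule is_isoI)
  hence "add_monoid R \<cong> free_Abelian_group (h ` U)"
    by (rule group.iso_sym[OF group_free_Abelian_group])
  thus ?thesis unfolding is_free_abelian_def using a_comm_group by blast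
qed

end

text \<open>The ring is no larger than its set of indeterminates, where the countably many spare
  ones are absorbed by \<open>A\<close>; conversely the main indeterminates embed
  \<open>A\<close>.\<close>

lemma ring_on_eqpoll:
  assumes "infinite A" shows "ring_on A \<approx> A"
proof (rule lepoll_antisym)
  have "ring_on A \<lesssim> Main ` A \<union> range Spare"
    by (rule nagata_lepoll) (use assms in \<open>auto dest: finite_imageD simp: inj_on_def\<close>)
  also have "\<dots> \<lesssim> A"
  proof -
    have "|Main ` A \<union> range Spare| \<le>o |A|"
      using assms infinite_iff_card_of_nat ordLeq_transitive[OF card_of_image]
      by (intro card_of_Un_ordLeq_infinite card_of_image) blast+
    thus ?thesis by (simp add: lepoll_def card_of_ordLeq)
  qed
  finally show "ring_on A \<lesssim> A" .
next
  define x where "x i = (Poly_Mapping.single (Poly_Mapping.single (Main i) 1) 1 :: 'a indet mpoly)" for i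
  have "inj_on (\<lambda>i. to_fract (x i)) A"
    by (rule inj_onI) (auto simp: x_def dest!: arg_cong[of _ _ Poly_Mapping.keys])
  moreover have "(\<lambda>i. to_fract (x i)) ` A \<subseteq> ring_on A"
  proof
    fix y assume "y \<in> (\<lambda>i. to_fract (x i)) ` A"
    then obtain i where i: "i \<in> A" "y = to_fract (x i) / to_fract 1" by auto
    moreover have "x i \<in> polys_on (Main ` A \<union> range Spare)" using i by (simp add: x_def polys_on_def)
    ultimately show "y \<in> ring_on A" by (metis nagataI polys_on_one int_pure_one)
  qed
  ultimately show "A \<lesssim> ring_on A" unfolding lepoll_def by blast
qed

theorem mainTheorem1:
  fixes \<kappa> :: "'a rel"
  assumes "Cinfinite \<kappa>"
  shows "\<exists>R :: 'a ring. noetherian_domain R \<and> |carrier R| =o \<kappa> \<and> is_free_abelian (add_monoid R)"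
proof -
  define A where "A = Field \<kappa>"
  have "infinite A" and card: "|A| =o \<kappa>"
    using assms by (simp_all add: A_def cinfinite_def card_of_Field_ordIso)
  \<comment> \<open>The carrier of the copy will be \<open>Field \<kappa>\<close> itself.\<close>
  obtain h where h: "bij_betw h (ring_on A) A"
    using ring_on_eqpoll[OF \<open>infinite A\<close>] unfolding eqpoll_def by blast
  interpret subring_copy "ring_on A" h
    by unfold_locales (use h in \<open>auto simp: bij_betw_def subspace_nagata nagata_mult\<close>)
  obtain U where U: "U \<subseteq> ring_on A" "zmod.independent U" "ring_on A \<subseteq> zmod.span U"
    by (rule ring_on_has_basis)
  have "noetherian_domain R"
  proof (rule noetherian_copy)
    fix y assume y: "y \<in> ring_on A" "y \<noteq> 0"
    then obtain n u where "y = of_int n * u" "u \<in> ring_on A" "inverse u \<in> ring_on A" "u \<noteq> 0"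
      by (rule nagata_int_times_unit)
    thus "\<exists>n u v. y = of_int n * u \<and> u \<in> ring_on A \<and> v \<in> ring_on A \<and> u * v = 1"
      by (intro exI[of _ n] exI[of _ u] exI[of _ "inverse u"]) simp
  qed
  moreover have "|carrier R| =o \<kappa>" using card h by (simp add: carrier_copy bij_betw_def)
  moreover have "is_free_abelian (add_monoid R)" using U by (rule free_abelian_copy)
  ultimately show ?thesis by blast
qed

end
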